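(* Let $p$ be a prime, let $s \geq 1$ be an integer, and let $q = p^s$. Let $G$ be a primitive divergent graph. Then $$c_2^{(q)}(G) \equiv (-1)^{s+1}\bigl(c_2^{(p)}(G)\bigr)^s \pmod p .$$
   Context: Graphs are finite. Let $K$ be a connected 4-regular simple graph and let $G = K - v$ for some vertex $v$ of $K$ (the vertex $v$ and its four incident edges are deleted). Then $G$ is called a decompletion of $K$ and $K$ the completion of $G$. The graph $K$ is internally 6-edge connected if removing any 5 edges of $K$ results in a graph with at most one connected component that is not an isolated vertex. A graph $G$ is primitive divergent if it is a decompletion of a connected 4-regular simple graph $K$ that is internally 6-edge connected. Associate a variable $\alpha_e$ to each edge $e$ of $G$. The Kirchhoff polynomial of $G$ is $$\Psi_G = \sum_T \prod_{e \notin T} \alpha_e \in \mathbb{Z}[\alpha_e : e \in E(G)],$$ where the sum runs over all spanning trees $T$ of $G$ and the product over the edges of $G$ not in $T$. For a prime power $q$ let $\mathbb{F}_q$ be the field with $q$ elements. For $F \in \mathbb{Z}[x_1,\ldots,x_N]$ let $[F]_q = |\{x \in \mathbb{F}_q^N : F(x) = 0\}|$, where the coefficients of $F$ are mapped to $\mathbb{F}_q$. For $\Psi_G$ the number of variables is $N = |E(G)|$. For $G$ connected with $|V(G)| \geq 3$ and $q$ a prime power, it is known that $q^2$ divides $[\Psi_G]_q$, and the $c_2$ invariant of $G$ at $q$ is the residue class $$c_2^{(q)}(G) = \frac{[\Psi_G]_q}{q^2} \bmod q .$$ Since $p \mid q$, this residue modulo $q=p^s$ has a well-defined reduction modulo $p$,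 which is what the congruence in the claim refers to. *)

theory Defs
  imports
    "HOL-Library.Cardinality"
    "HOL-Library.FuncSet"
    "HOL-Library.Poly_Mapping"
    "HOL-Number_Theory.Cong"
begin

section \<open>Simple graphs\<close>

text \<open>
  A graph is a pair of a vertex set and a set of edges, each edge being the
  two-element set of its endpoints. In particular every undirected edge is a single object,
  so that it can carry a single variable of the Kirchhoff polynomial.
\<close>

type_synonym 'v ugraph = "'v set \<times> 'v set set"

abbreviation verts :: "'v ugraph \<Rightarrow> 'v set" where
  "verts G \<equiv> fst G"

abbreviation edges :: "'v ugraph \<Rightarrow> 'v set set" where
  "edges G \<equiv> snd G"

definition simple_graph :: "'v ugraph \<Rightarrow> bool" where
  "simple_graph G \<longleftrightarrow>
     finite (verts G) \<and> (\<forall>e\<in>edges G. e \<subseteq> verts G \<and> card e = 2)"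

definition adj :: "'v ugraph \<Rightarrow> ('v \<times> 'v) set" where
  "adj G = {(u, w). {u, w} \<in> edges G}"

definition components :: "'v ugraph \<Rightarrow> 'v set set" where
  "components G = (\<lambda>u. {w \<in> verts G. (u, w) \<in> (adj G)\<^sup>*}) ` verts G"

definition connected_graph :: "'v ugraph \<Rightarrow> bool" where
  "connected_graph G \<longleftrightarrow>
     verts G \<noteq> {} \<and> (\<forall>u\<in>verts G. \<forall>w\<in>verts G. (u, w) \<in> (adj G)\<^sup>*)"

definition regular :: "nat \<Rightarrow> 'v ugraph \<Rightarrow> bool" where
  "regular d G \<longleftrightarrow> (\<forall>u\<in>verts G. card {e \<in> edges G. u \<in> e} = d)"

definition delete_vertex :: "'v ugraph \<Rightarrow> 'v \<Rightarrow> 'v ugraph" where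
  "delete_vertex G v = (verts G - {v}, {e \<in> edges G. v \<notin> e})"

definition delete_edges :: "'v ugraph \<Rightarrow> 'v set set \<Rightarrow> 'v ugraph" where
  "delete_edges G S = (verts G, edges G - S)"

text \<open>A connected component is an isolated vertex iff it has exactly one vertex.\<close>

definition internally_6_edge_connected :: "'v ugraph \<Rightarrow> bool" where
  "internally_6_edge_connected K \<longleftrightarrow>
     (\<forall>S. S \<subseteq> edges K \<and> card S = 5 \<longrightarrow>
        card {C \<in> components (delete_edges K S). card C \<noteq> 1} \<le> 1)"

definition is_decompletion :: "'v ugraph \<Rightarrow> 'v ugraph \<Rightarrow> bool" where
  "is_decompletion G K \<longleftrightarrow>
     simple_graph K \<and> connected_graph K \<and> regular 4 K \<and>
     (\<exists>v\<in>verts K. G = delete_vertex K v)"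

definition primitive_divergent :: "'v ugraph \<Rightarrow> bool" where
  "primitive_divergent G \<longleftrightarrow>
     (\<exists>K. is_decompletion G K \<and> internally_6_edge_connected K)"

section \<open>Spanning trees and the Kirchhoff polynomial\<close>

text \<open>A cycle is given by its vertices in cyclic order, without repeating the first one.\<close>

definition is_cycle :: "'v ugraph \<Rightarrow> 'v list \<Rightarrow> bool" where
  "is_cycle G vs \<longleftrightarrow>
     length vs \<ge> 3 \<and> distinct vs \<and>
     (\<forall>i<length vs. {vs ! i, vs ! (Suc i mod length vs)} \<in> edges G)"

definition is_tree :: "'v ugraph \<Rightarrow> bool" where
  "is_tree G \<longleftrightarrow> simple_graph G \<and> connected_graph G \<and> (\<nexists>vs. is_cycle G vs)"

text \<open>Spanning trees of a graph are identified with their edge sets.\<close>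

definition spanning_trees :: "'v ugraph \<Rightarrow> 'v set set set" where
  "spanning_trees G = {T. T \<subseteq> edges G \<and> is_tree (verts G, T)}"

text \<open>
  Polynomials over the integers in variables indexed by a type: a monomial is a finitely
  supported exponent function, a polynomial a finitely supported coefficient function on
  monomials.
\<close>

type_synonym 'i int_mpoly = "('i \<Rightarrow>\<^sub>0 nat) \<Rightarrow>\<^sub>0 int"

definition var :: "'i \<Rightarrow> 'i int_mpoly" where
  "var i = Poly_Mapping.single (Poly_Mapping.single i 1) 1"

definition eval_mpoly :: "('i \<Rightarrow> 'k) \<Rightarrow> 'i int_mpoly \<Rightarrow> 'k::comm_ring_1" where
  "eval_mpoly x F =
     (\<Sum>m\<in>Poly_Mapping.keys F.
        of_int (Poly_Mapping.lookup F m) *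
        (\<Prod>i\<in>Poly_Mapping.keys m. x i ^ Poly_Mapping.lookup m i))"

definition kirchhoff :: "'v ugraph \<Rightarrow> 'v set int_mpoly" where
  "kirchhoff G = (\<Sum>T\<in>spanning_trees G. \<Prod>e\<in>edges G - T. var e)"

section \<open>Point counts and the \<open>c\<^sub>2\<close> invariant\<close>

text \<open>
  The field with \<open>q\<close> elements is represented by a finite field type of cardinality \<open>q\<close>; it
  is unique up to isomorphism, so the counts below depend only on \<open>q\<close>. The number of zeros
  is taken in the affine space with coordinates indexed by \<open>I\<close>, regardless of which of these
  variables occur in \<open>F\<close>.
\<close>

definition point_count :: "'k::{field,finite} itself \<Rightarrow> 'i set \<Rightarrow> 'i int_mpoly \<Rightarrow> nat" where
  "point_count _ I F = card {x \<in> I \<rightarrow>\<^sub>E (UNIV :: 'k set). eval_mpoly x F = 0}"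

text \<open>
  The residue class modulo \<open>q\<close> is represented by its element in \<open>{0..<q}\<close>. The division by
  \<open>q\<^sup>2\<close> is exact for connected graphs with at least three vertices.
\<close>

definition c2 :: "'k::{field,finite} itself \<Rightarrow> 'v ugraph \<Rightarrow> int" where
  "c2 k G =
     (int (point_count k (edges G) (kirchhoff G)) div int (CARD('k) ^ 2)) mod int (CARD('k))"

end

theory Submission
  imports Defs
    "HOL-Combinatorics.Permutations"
    "HOL-Computational_Algebra.Polynomial"
begin

text \<open>
  Let \<open>r\<close> and \<open>u\<close> be two of the four vertices of degree 3 of \<open>G\<close>. With the edges \<open>e1, e2, e3\<close> at \<open>r\<close>
  the Kirchhoff polynomial is, up to sign, \<open>f (a1 a2 + a1 a3 + a2 a3) + a3 A + a2 B + a1 (A + B - 2 C) + R\<close>,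
  where the minors \<open>f, A, B, C, R\<close> of the incidence matrix involve only the other edges and satisfy
  \<open>f R = A B - C\<^sup>2\<close> (Jacobi). Counting over \<open>a1, a2, a3\<close> shows that the number of zeros divided by \<open>q\<^sup>2\<close> is
  congruent to \<open>- #{f = A = B = 0}\<close> modulo \<open>q\<close>. As \<open>A B = C\<^sup>2\<close> where \<open>f = 0\<close>, this number is
  \<open>#{f = A = 0} + #{f = B = 0} - #{f = C = 0}\<close>. The first two counts vanish modulo \<open>p\<close>, since the
  second vertex \<open>u\<close> supplies the divisibility by \<open>p q\<close> of the counts for \<open>f\<close> and for \<open>f a + A\<close>;
  the third is \<open>- #{f C = 0}\<close> by Chevalley-Warning. Hence \<open>c\<^sub>2\<close> is congruent to \<open>- #{f C = 0}\<close>, and the degree of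
  \<open>f C\<close> is at most its number of variables, which is odd. For such a polynomial \<open>F\<close> the number of zeros over the
  field with \<open>p ^ s\<close> elements is \<open>a ^ s\<close> modulo \<open>p\<close>, where \<open>a\<close> is the coefficient of the product of all
  \<open>x ^ (p - 1)\<close> in \<open>F ^ (p - 1)\<close>: write \<open>F ^ (p ^ s - 1)\<close> as the product of the \<open>(F ^ (p - 1)) ^ (p ^ j)\<close>.
\<close>

section \<open>Determinants over finite index sets\<close>

text \<open>The obstacle is the division by \<open>q^2\<close>: degree arguments see counts only
  modulo \<open>p\<close>, and the Kirchhoff polynomial has degree only half its number of
  variables. Passing to \<open>f C\<close> trades the quotient for a plain count of borderline
  degree. Write W for the vertices other than \<open>r\<close> and T for the edges not at
  \<open>r\<close>. As |T| + 3 = 2 |W|, the degrees |T| + 1 - |W| of \<open>f\<close> and |T| + 2 -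
  |W| of \<open>C\<close> add up to |T|, and a single monomial decides the count. Its coefficient a
  is an integer depending on \<open>p\<close> but not on \<open>s\<close>, so c2 is congruent to
  -a^s for every \<open>s\<close>. The case \<open>s = 1\<close> gives a = -c2 over the prime field,
  whence the sign \<open>(-1)^(s+1)\<close>. Modulo \<open>p\<close> alone is too weak for
  \<open>f\<close> and \<open>f a + A\<close>: in their zero counts #{f = A = 0} occurs with the
  factor \<open>q\<close>, which has to be cancelled; hence divisibility by \<open>p q\<close>.
  Determinants are taken of the block matrix with the variables on the diagonal of the edges and the
  incidence matrix beside it, not of the Laplacian. Each variable then sits in one entry: deleting
  an edge drops an index, contracting it puts 0 on the diagonal.\<close>

definition det_on :: "'a set \<Rightarrow> ('a \<Rightarrow> 'a \<Rightarrow> 'r::comm_ring_1) \<Rightarrow> 'r" where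
  "det_on A M = (\<Sum>\<pi> | \<pi> permutes A. of_int (sign \<pi>) * (\<Prod>i\<in>A. M i (\<pi> i)))"

lemma det_on_empty [simp]: "det_on {} M = 1"
  by (simp add: det_on_def)

lemma det_on_cong:
  assumes "\<And>i j. i \<in> A \<Longrightarrow> j \<in> A \<Longrightarrow> M i j = N i j"
  shows "det_on A M = det_on A N"
  unfolding det_on_def
  by (intro sum.cong arg_cong2[where f = "(*)"] prod.cong refl)
    (use assms in \<open>auto simp: permutes_in_image\<close>)

lemma det_on_transpose:
  assumes "finite A"
  shows "det_on A (\<lambda>i j. M j i) = det_on A M"
proof -
  have "det_on A (\<lambda>i j. M j i)
      = (\<Sum>\<pi> | \<pi> permutes A. of_int (sign (inv \<pi>)) * (\<Prod>i\<in>A. M (inv \<pi> i) i))"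
    unfolding det_on_def by (rule sum_permutations_inverse)
  also have "\<dots> = det_on A M"
    unfolding det_on_def
  proof (intro sum.cong refl)
    fix \<pi> assume "\<pi> \<in> {\<pi>. \<pi> permutes A}"
    hence p: "\<pi> permutes A" by simp
    have "(\<Prod>i\<in>A. M (inv \<pi> i) i) = (\<Prod>i\<in>A. M i (\<pi> i))"
      by (subst prod.permute[OF p]) (simp add: permutes_inverses(2)[OF p] o_def)
    moreover have "sign (inv \<pi>) = sign \<pi>"
      using p assms permutation_permutes sign_inverse by blast
    ultimately show "of_int (sign (inv \<pi>)) * (\<Prod>i\<in>A. M (inv \<pi> i) i)
        = of_int (sign \<pi>) * (\<Prod>i\<in>A. M i (\<pi> i))" by simp
  qed
  finally show ?thesis .
qed

lemma det_on_swap_cols: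
  assumes "finite A" "a \<in> A" "b \<in> A" "a \<noteq> b"
  shows "det_on A (\<lambda>i j. M i (transpose a b j)) = - det_on A M"
proof -
  have t: "transpose a b permutes A" using assms by (simp add: permutes_swap_id)
  have "det_on A M = (\<Sum>\<pi> | \<pi> permutes A. of_int (sign (transpose a b \<circ> \<pi>)) *
      (\<Prod>i\<in>A. M i ((transpose a b \<circ> \<pi>) i)))"
    unfolding det_on_def by (rule setum_permutations_compose_left[OF t])
  also have "\<dots> = (\<Sum>\<pi> | \<pi> permutes A. - (of_int (sign \<pi>) *
      (\<Prod>i\<in>A. M i (transpose a b (\<pi> i)))))"
  proof (intro sum.cong refl)
    fix \<pi> assume "\<pi> \<in> {\<pi>. \<pi> permutes A}"
    hence "permutation \<pi>" using assms permutation_permutes by blast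
    hence "sign (transpose a b \<circ> \<pi>) = - sign \<pi>"
      using assms by (simp add: sign_compose permutation_swap_id sign_swap_id)
    thus "of_int (sign (transpose a b \<circ> \<pi>)) * (\<Prod>i\<in>A. M i ((transpose a b \<circ> \<pi>) i))
        = - (of_int (sign \<pi>) * (\<Prod>i\<in>A. M i (transpose a b (\<pi> i))))" by simp
  qed
  finally show ?thesis by (simp add: det_on_def sum_negf)
qed

text \<open>Conjugation by a transposition preserves signs. Exchanging one index for another makes
  determinants over different edge sets comparable.\<close>

lemma det_on_relabel:
  assumes "finite A"
  shows "det_on (transpose a b ` A) M
    = det_on A (\<lambda>i j. M (transpose a b i) (transpose a b j))"
proof -
  let ?t = "transpose a b"
  have [simp]: "?t ` ?t ` B = B" for B by (simp add: image_comp)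
  have perm: "?t \<circ> \<pi> \<circ> ?t permutes ?t ` B" if p: "\<pi> permutes B" for \<pi> B
  proof (rule bij_imp_permutes)
    have "bij_betw ?t (?t ` B) B"
      by (rule bij_betwI[where g = ?t]) auto
    moreover have "bij_betw ?t B (?t ` B)"
      by (rule bij_betwI[where g = ?t]) auto
    ultimately show "bij_betw (?t \<circ> \<pi> \<circ> ?t) (?t ` B) (?t ` B)"
      using permutes_imp_bij[OF p] by (blast intro: bij_betw_trans)
    fix x assume "x \<notin> ?t ` B"
    hence "?t x \<notin> B" by (metis imageI transpose_involutory)
    thus "(?t \<circ> \<pi> \<circ> ?t) x = x" by (simp add: permutes_not_in[OF p])
  qed
  show ?thesis unfolding det_on_def
  proof (rule sum.reindex_bij_witness[of _ "\<lambda>\<pi>. ?t \<circ> \<pi> \<circ> ?t" "\<lambda>\<pi>. ?t \<circ> \<pi> \<circ> ?t"])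
    fix \<pi> assume "\<pi> \<in> {\<pi>. \<pi> permutes ?t ` A}"
    hence p: "\<pi> permutes ?t ` A" by simp
    show "?t \<circ> \<pi> \<circ> ?t \<in> {\<pi>. \<pi> permutes A}" using perm[OF p] by simp
    have "permutation \<pi>" using p assms permutation_permutes by blast
    hence "sign (?t \<circ> \<pi> \<circ> ?t) = sign \<pi>"
      by (auto simp: sign_compose permutation_swap_id permutation_compose sign_swap_id)
    moreover have "(\<Prod>i\<in>A. M (?t i) (?t ((?t \<circ> \<pi> \<circ> ?t) i))) = (\<Prod>i\<in>?t ` A. M i (\<pi> i))"
      by (subst prod.reindex) (auto intro: inj_on_inverseI[of _ ?t ?t])
    ultimately show "of_int (sign (?t \<circ> \<pi> \<circ> ?t)) * (\<Prod>i\<in>A. M (?t i) (?t ((?t \<circ> \<pi> \<circ> ?t) i)))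
       = of_int (sign \<pi>) * (\<Prod>i\<in>?t ` A. M i (\<pi> i))" by simp
  qed (use perm in \<open>auto simp: fun_eq_iff\<close>)
qed

lemma det_on_row_sum:
  assumes "finite A" "k \<in> A"
  shows "det_on A (M(k := \<lambda>j. \<Sum>l\<in>L. c l * R l j)) = (\<Sum>l\<in>L. c l * det_on A (M(k := R l)))"
proof -
  have split: "(\<Prod>i\<in>A. (M(k := r)) i (\<pi> i)) = r (\<pi> k) * (\<Prod>i\<in>A - {k}. M i (\<pi> i))" for r \<pi>
    using assms by (subst prod.remove[of _ k]) auto
  show ?thesis
    unfolding det_on_def split sum_distrib_left sum_distrib_right
    by (subst sum.swap) (simp add: mult_ac)
qed

lemma det_on_row_add:
  assumes "finite A" "k \<in> A"
  shows "det_on A (M(k := \<lambda>j. r j + s j)) = det_on A (M(k := r)) + det_on A (M(k := s))"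
  using det_on_row_sum[OF assms, of M "\<lambda>_. 1" "\<lambda>b. if b then r else s" UNIV]
  by (simp add: UNIV_bool add.commute)

lemma det_on_row_diff:
  assumes "finite A" "k \<in> A"
  shows "det_on A (M(k := \<lambda>j. r j - s j)) = det_on A (M(k := r)) - det_on A (M(k := s))"
  using det_on_row_add[OF assms, of M "\<lambda>j. r j - s j" s] by simp

text \<open>Antisymmetry alone would give twice the determinant equal to 0, which says nothing in
  characteristic 2. Instead the even and the odd permutations are matched by composing with the
  transposition, and their products cancel in pairs.\<close>

lemma det_on_equal_rows:
  assumes "finite A" "i \<in> A" "j \<in> A" "i \<noteq> j" "\<And>k. k \<in> A \<Longrightarrow> M i k = M j k"
  shows "det_on A M = 0"
proof -
  let ?t = "transpose i j"
  let ?f = "\<lambda>\<pi>. \<Prod>k\<in>A. M k (\<pi> k)"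
  let ?P = "{\<pi>. \<pi> permutes A}"
  have t: "?t permutes A" using assms by (simp add: permutes_swap_id)
  have fin: "finite ?P" using assms by (simp add: finite_permutations)
  have f: "?f (\<pi> \<circ> ?t) = ?f \<pi>" if "\<pi> permutes A" for \<pi>
  proof -
    have "?f (\<pi> \<circ> ?t) = (\<Prod>k\<in>A. M (?t k) (\<pi> k))"
      by (subst prod.permute[OF t]) (simp add: o_def)
    also have "\<dots> = ?f \<pi>"
    proof (rule prod.cong)
      fix k assume "k \<in> A"
      hence "\<pi> k \<in> A" using that by (simp add: permutes_in_image)
      thus "M (?t k) (\<pi> k) = M k (\<pi> k)" using assms(5) by (auto simp: transpose_def)
    qed simp
    finally show ?thesis .
  qed
  have ev: "evenperm (\<pi> \<circ> ?t) \<longleftrightarrow> \<not> evenperm \<pi>" if "\<pi> permutes A" for \<pi>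
  proof -
    have "permutation \<pi>" using that assms permutation_permutes by blast
    thus ?thesis using assms by (simp add: evenperm_comp permutation_swap_id evenperm_swap)
  qed
  have "det_on A M = (\<Sum>\<pi>\<in>?P. (if evenperm \<pi> then ?f \<pi> else 0) - (if evenperm \<pi> then 0 else ?f \<pi>))"
    unfolding det_on_def by (intro sum.cong) (auto simp: sign_def)
  also have "\<dots> = (\<Sum>\<pi>\<in>?P. if evenperm \<pi> then ?f \<pi> else 0) - (\<Sum>\<pi>\<in>?P. if evenperm \<pi> then 0 else ?f \<pi>)"
    by (rule sum_subtractf)
  also have "(\<Sum>\<pi>\<in>?P. if evenperm \<pi> then ?f \<pi> else 0)
     = (\<Sum>\<pi>\<in>?P. if evenperm (\<pi> \<circ> ?t) then ?f (\<pi> \<circ> ?t) else 0)"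
    by (rule sum_permutations_compose_right[OF t])
  also have "\<dots> = (\<Sum>\<pi>\<in>?P. if evenperm \<pi> then 0 else ?f \<pi>)"
  proof (rule sum.cong)
    fix \<pi> assume "\<pi> \<in> ?P"
    hence "\<pi> permutes A" by simp
    thus "(if evenperm (\<pi> \<circ> ?t) then ?f (\<pi> \<circ> ?t) else 0) = (if evenperm \<pi> then 0 else ?f \<pi>)"
      using ev f by presburger
  qed simp
  finally show ?thesis by simp
qed

lemma det_on_row_unit:
  assumes "finite A" "a \<notin> A" "\<And>j. j \<in> A \<Longrightarrow> M a j = 0"
  shows "det_on (insert a A) M = M a a * det_on A M"
proof -
  let ?g = "\<lambda>\<pi>. of_int (sign \<pi>) * (\<Prod>i\<in>insert a A. M i (\<pi> i))"
  have "det_on (insert a A) M = (\<Sum>\<pi> | \<pi> permutes A. ?g \<pi>)"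
    unfolding det_on_def
  proof (rule sum.mono_neutral_right)
    show "finite {\<pi>. \<pi> permutes insert a A}" using assms by (simp add: finite_permutations)
    show "{\<pi>. \<pi> permutes A} \<subseteq> {\<pi>. \<pi> permutes insert a A}"
      by (auto intro: permutes_subset)
    show "\<forall>\<pi>\<in>{\<pi>. \<pi> permutes insert a A} - {\<pi>. \<pi> permutes A}. ?g \<pi> = 0"
    proof
      fix \<pi> assume "\<pi> \<in> {\<pi>. \<pi> permutes insert a A} - {\<pi>. \<pi> permutes A}"
      hence p: "\<pi> permutes insert a A" and np: "\<not> \<pi> permutes A" by auto
      have "\<pi> a \<noteq> a"
        using permutes_superset[OF p, of A] np by auto
      hence "\<pi> a \<in> A" using permutes_in_image[OF p, of a] by auto
      hence "M a (\<pi> a) = 0" by (rule assms(3))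
      thus "?g \<pi> = 0" using assms by simp
    qed
  qed
  also have "\<dots> = (\<Sum>\<pi> | \<pi> permutes A. M a a * (of_int (sign \<pi>) * (\<Prod>i\<in>A. M i (\<pi> i))))"
    using assms by (intro sum.cong) (auto simp: permutes_not_in)
  finally show ?thesis by (simp add: det_on_def sum_distrib_left)
qed

lemma det_on_col_unit:
  assumes "finite A" "a \<notin> A" "\<And>i. i \<in> A \<Longrightarrow> M i a = 0"
  shows "det_on (insert a A) M = M a a * det_on A M"
  using det_on_row_unit[of A a "\<lambda>i j. M j i"] assms
    det_on_transpose[of A M] det_on_transpose[of "insert a A" M] by simp

text \<open>Linearity in one diagonal entry; for the incidence matrix this becomes
  deletion-contraction of an edge.\<close>

lemma det_on_diag_shift:
  assumes "finite A" "a \<notin> A"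
  shows "det_on (insert a A) (M(a := (M a)(a := M a a + t)))
    = t * det_on A M + det_on (insert a A) M"
proof -
  have "det_on (insert a A) (M(a := \<lambda>j. (if j = a then t else 0) + M a j))
     = det_on (insert a A) (M(a := \<lambda>j. if j = a then t else 0)) + det_on (insert a A) (M(a := M a))"
    using assms by (intro det_on_row_add) auto
  also have "det_on (insert a A) (M(a := \<lambda>j. if j = a then t else 0)) = t * det_on A M"
    using assms by (subst det_on_row_unit) (auto intro!: arg_cong2[where f = "(*)"] det_on_cong)
  also have "det_on (insert a A) (M(a := \<lambda>j. (if j = a then t else 0) + M a j))
     = det_on (insert a A) (M(a := (M a)(a := M a a + t)))"
    by (rule det_on_cong) auto
  finally show ?thesis by simp
qed

text \<open>In the transposed matrix, overwriting row \<open>k\<close> by the combination with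
  coefficients \<open>z\<close> multiplies the determinant by \<open>z k\<close> and also produces a
  zero row.\<close>

lemma det_on_null_vector:
  fixes M :: "'a \<Rightarrow> 'a \<Rightarrow> 'r::idom"
  assumes "finite A" "\<And>i. i \<in> A \<Longrightarrow> (\<Sum>j\<in>A. M i j * z j) = 0" "k \<in> A" "z k \<noteq> 0"
  shows "det_on A M = 0"
proof -
  let ?N = "\<lambda>i j. M j i"
  \<comment> \<open>The empty combination serves as the zero row, so that linearity also covers this
    case.\<close>
  have "0 = det_on A (?N(k := \<lambda>j. \<Sum>l\<in>{}. 0 * ?N l j))"
    using assms by (subst det_on_row_sum) auto
  also have "\<dots> = det_on A (?N(k := \<lambda>j. \<Sum>l\<in>A. z l * ?N l j))"
    using assms(2) by (intro det_on_cong) (auto simp: mult.commute)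
  also have "\<dots> = (\<Sum>l\<in>A. z l * det_on A (?N(k := ?N l)))"
    using assms by (intro det_on_row_sum)
  also have "\<dots> = (\<Sum>l\<in>A. if l = k then z k * det_on A ?N else 0)"
  proof (rule sum.cong)
    fix l assume "l \<in> A"
    moreover have "det_on A (?N(k := ?N k)) = det_on A ?N" by (rule det_on_cong) auto
    ultimately show "z l * det_on A (?N(k := ?N l)) = (if l = k then z k * det_on A ?N else 0)"
      using det_on_equal_rows[of A l k "?N(k := ?N l)"] assms by (cases "l = k") simp_all
  qed simp
  also have "\<dots> = z k * det_on A M" using assms det_on_transpose[OF assms(1), of M] by simp
  finally show ?thesis using assms by simp
qed

text \<open>By the pigeonhole principle no permutation maps \<open>B\<close> into \<open>A\<close>,
  so each product picks an entry of the zero block.\<close>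

lemma det_on_zero_block:
  assumes "finite A" "finite B" "A \<inter> B = {}" "card B > card A"
    and "\<And>i j. i \<in> B \<Longrightarrow> j \<in> B \<Longrightarrow> M i j = 0"
  shows "det_on (A \<union> B) M = 0"
  unfolding det_on_def
proof (intro sum.neutral ballI)
  fix \<pi> assume "\<pi> \<in> {\<pi>. \<pi> permutes A \<union> B}"
  hence p: "\<pi> permutes A \<union> B" by simp
  have "\<not> \<pi> ` B \<subseteq> A"
    using assms card_inj_on_le[OF inj_on_subset[OF permutes_inj[OF p] subset_UNIV], of B A] by auto
  then obtain b where "b \<in> B" "\<pi> b \<in> B" using permutes_in_image[OF p] by blast
  hence "(\<Prod>i\<in>A \<union> B. M i (\<pi> i)) = 0" using assms by (intro prod_zero) auto
  thus "of_int (sign \<pi>) * (\<Prod>i\<in>A \<union> B. M i (\<pi> i)) = 0" by simp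
qed

text \<open>Meant for a leaf vertex \<open>a\<close> and its edge \<open>b\<close>: apart from index
  \<open>b\<close>, the row and the column of \<open>a\<close> vanish. Swapping the two columns
  makes two unit expansions possible and causes the sign.\<close>

lemma det_on_pendant:
  assumes "finite A" "a \<notin> A" "b \<notin> A" "a \<noteq> b"
    and "\<And>j. j \<in> A \<Longrightarrow> M a j = 0" "\<And>i. i \<in> A \<Longrightarrow> M i a = 0" "M a a = 0"
  shows "det_on (insert a (insert b A)) M = - (M a b * M b a) * det_on A M"
proof -
  let ?N = "\<lambda>i j. M i (transpose a b j)"
  have "det_on (insert a (insert b A)) ?N = ?N a a * det_on (insert b A) ?N"
    using assms by (intro det_on_row_unit) (auto simp: transpose_def)
  also have "det_on (insert b A) ?N = ?N b b * det_on A ?N"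
    using assms by (intro det_on_col_unit) auto
  also have "det_on A ?N = det_on A M"
    using assms by (intro det_on_cong) (auto simp: transpose_def)
  finally have "- det_on (insert a (insert b A)) M = M a b * M b a * det_on A M"
    using det_on_swap_cols[of "insert a (insert b A)" a b M] assms by simp
  thus ?thesis by (metis minus_minus mult_minus_left)
qed

section \<open>Cofactors and the Desnanot-Jacobi identity\<close>

lemma det_on_row_expand:
  assumes "finite A" "k \<in> A"
  shows "det_on A M = (\<Sum>l\<in>A. M k l * det_on A (M(k := \<lambda>j. if j = l then 1 else 0)))"
proof -
  have "det_on A M = det_on A (M(k := \<lambda>j. \<Sum>l\<in>A. M k l * (if j = l then 1 else 0)))"
    using assms by (intro det_on_cong) (auto simp: if_distrib cong: if_cong)
  also have "\<dots> = (\<Sum>l\<in>A. M k l * det_on A (M(k := \<lambda>j. if j = l then 1 else 0)))"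
    using assms by (rule det_on_row_sum)
  finally show ?thesis .
qed

text \<open>A permutation contributes only if it sends \<open>k\<close> to \<open>l\<close>, and
  then no other row meets column \<open>l\<close>. This turns a cofactor written with a unit row
  into one written with a unit column.\<close>

lemma det_on_unit_row_clear_col:
  assumes "finite A" "k \<in> A" "l \<in> A"
  shows "det_on A (\<lambda>i j. if i = k then (if j = l then 1 else 0) else if j = l then c i else M i j)
    = det_on A (M(k := \<lambda>j. if j = l then 1 else 0))"
  unfolding det_on_def
proof (intro sum.cong refl arg_cong2[where f = "(*)"])
  fix \<pi> assume "\<pi> \<in> {\<pi>. \<pi> permutes A}"
  hence p: "\<pi> permutes A" by simp
  show "(\<Prod>i\<in>A. if i = k then if \<pi> i = l then 1 else 0 else if \<pi> i = l then c i else M i (\<pi> i)) =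
    (\<Prod>i\<in>A. (M(k := \<lambda>j. if j = l then 1 else 0)) i (\<pi> i))"
  proof (cases "\<pi> k = l")
    case True
    thus ?thesis using permutes_inj[OF p] by (intro prod.cong) (auto dest: injD)
  next
    case False
    thus ?thesis using assms by (simp add: prod.remove[of _ k])
  qed
qed

text \<open>The determinants with a unit row are the cofactors of the entries \<open>(k, a)\<close>.
  Summing them against column \<open>l\<close> expands the matrix whose column \<open>a\<close> is
  overwritten by column \<open>l\<close>.\<close>

lemma det_on_cramer:
  assumes "finite A" "a \<in> A" "l \<in> A"
  shows "(\<Sum>k\<in>A. det_on A (M(k := \<lambda>j. if j = a then 1 else 0)) * M k l)
    = (if l = a then det_on A M else 0)"
proof -
  let ?N = "\<lambda>i j. M j i"
  let ?L = "?N(a := ?N l)"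
  have eq: "det_on A (?L(a := \<lambda>j. if j = k then 1 else 0)) = det_on A (M(k := \<lambda>j. if j = a then 1 else 0))"
    if "k \<in> A" for k
  proof -
    have "det_on A (M(k := \<lambda>j. if j = a then 1 else 0)) =
      det_on A (\<lambda>i j. if i = k then (if j = a then 1 else 0) else if j = a then 0 else M i j)"
      using det_on_unit_row_clear_col[OF assms(1) that assms(2), of "\<lambda>_. 0" M] by simp
    also have "\<dots> = det_on A (\<lambda>j i. if i = k then (if j = a then 1 else 0) else if j = a then 0 else M i j)"
      by (rule det_on_transpose[OF assms(1), symmetric])
    also have "\<dots> = det_on A (\<lambda>i j. if i = a then (if j = k then 1 else 0) else if j = k then 0 else ?L i j)"
      by (rule det_on_cong) auto
    also have "\<dots> = det_on A (?L(a := \<lambda>j. if j = k then 1 else 0))"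
      using det_on_unit_row_clear_col[OF assms(1) assms(2) that, of "\<lambda>_. 0" ?L] by simp
    finally show ?thesis ..
  qed
  have "(\<Sum>k\<in>A. det_on A (M(k := \<lambda>j. if j = a then 1 else 0)) * M k l)
     = (\<Sum>k\<in>A. ?L a k * det_on A (?L(a := \<lambda>j. if j = k then 1 else 0)))"
    using eq by (intro sum.cong) (auto simp: mult.commute)
  also have "\<dots> = det_on A ?L"
    using det_on_row_expand[OF assms(1,2), of ?L] by simp
  also have "\<dots> = (if l = a then det_on A M else 0)"
  proof (cases "l = a")
    case True
    hence "det_on A ?L = det_on A ?N" by (intro det_on_cong) auto
    thus ?thesis using True det_on_transpose[OF assms(1), of M] by simp
  next
    case False
    thus ?thesis using det_on_equal_rows[of A l a ?L] assms by simp
  qed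
  finally show ?thesis .
qed

text \<open>The Desnanot-Jacobi identity, proved without division. In the block on
  \<open>insert a A\<close>, row \<open>a\<close> is replaced by the combination of all rows with
  the cofactors of column \<open>a\<close> as coefficients. By Cramer's rule this row is the full
  determinant times a unit vector. By linearity only the rows \<open>a\<close> and \<open>b\<close>
  contribute, since a row of \<open>A\<close> would occur twice.\<close>

lemma det_on_jacobi:
  assumes "finite A" "a \<notin> A" "b \<notin> A" "a \<noteq> b"
  shows "det_on (insert a (insert b A)) M * det_on A M
    = det_on (insert a A) M * det_on (insert b A) M
      - det_on (insert a A) (M(a := M b)) * det_on (insert a A) (\<lambda>i j. M i (if j = a then b else j))"
proof -
  define B where "B = insert a (insert b A)"
  let ?U = "\<lambda>j. if j = a then 1 else 0 :: 'b"
  let ?c = "\<lambda>k. det_on B (M(k := ?U))"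
  have B: "finite B" "a \<in> B" "b \<in> B" using assms by (auto simp: B_def)
  have ca: "?c a = det_on (insert b A) M"
  proof -
    have "?c a = (M(a := ?U)) a a * det_on (insert b A) (M(a := ?U))"
      unfolding B_def using assms by (intro det_on_row_unit) auto
    also have "\<dots> = det_on (insert b A) M"
      using assms by (auto intro!: det_on_cong)
    finally show ?thesis .
  qed
  have cb: "?c b = - det_on (insert a A) (\<lambda>i j. M i (if j = a then b else j))"
  proof -
    let ?N = "\<lambda>i j. (M(b := ?U)) i (transpose a b j)"
    have "det_on (insert b (insert a A)) ?N = ?N b b * det_on (insert a A) ?N"
      using assms by (intro det_on_row_unit) (auto simp: transpose_def)
    also have "\<dots> = det_on (insert a A) (\<lambda>i j. M i (if j = a then b else j))"
      using assms by (auto intro!: det_on_cong simp: transpose_def)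
    finally have "det_on B ?N = det_on (insert a A) (\<lambda>i j. M i (if j = a then b else j))"
      by (simp add: B_def insert_commute)
    thus ?thesis using det_on_swap_cols[of B a b "M(b := ?U)"] B assms by simp
  qed
  have "det_on (insert a A) (M(a := \<lambda>j. \<Sum>k\<in>B. ?c k * M k j))
      = (\<Sum>k\<in>B. ?c k * det_on (insert a A) (M(a := M k)))"
    using assms by (intro det_on_row_sum) auto
  also have "\<dots> = (\<Sum>k\<in>{a,b}. ?c k * det_on (insert a A) (M(a := M k)))"
  proof (rule sum.mono_neutral_right)
    show "\<forall>k\<in>B - {a, b}. ?c k * det_on (insert a A) (M(a := M k)) = 0"
    proof
      fix k assume "k \<in> B - {a, b}"
      hence "det_on (insert a A) (M(a := M k)) = 0"
        using assms by (intro det_on_equal_rows[of _ a k]) (auto simp: B_def)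
      thus "?c k * det_on (insert a A) (M(a := M k)) = 0" by simp
    qed
  qed (use B in auto)
  also have "\<dots> = ?c a * det_on (insert a A) M + ?c b * det_on (insert a A) (M(a := M b))"
    using assms by simp
  finally have "det_on (insert a A) (M(a := \<lambda>j. \<Sum>k\<in>B. ?c k * M k j)) = \<dots>" .
  moreover have "det_on (insert a A) (M(a := \<lambda>j. \<Sum>k\<in>B. ?c k * M k j)) = det_on B M * det_on A M"
  proof -
    let ?N = "M(a := \<lambda>j. if j = a then det_on B M else 0)"
    have "det_on (insert a A) (M(a := \<lambda>j. \<Sum>k\<in>B. ?c k * M k j)) = det_on (insert a A) ?N"
      using det_on_cramer[OF B(1,2), of _ M] by (intro det_on_cong) (auto simp: B_def)
    also have "\<dots> = ?N a a * det_on A ?N"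
      using assms by (intro det_on_row_unit) auto
    also have "det_on A ?N = det_on A M" using assms by (intro det_on_cong) auto
    also have "?N a a * det_on A M = det_on B M * det_on A M" by simp
    finally show ?thesis .
  qed
  ultimately show ?thesis using ca cb by (simp add: B_def algebra_simps)
qed

section \<open>Zeros of polynomials over finite fields\<close>

definition monom_val :: "('i \<Rightarrow> 'k::comm_ring_1) \<Rightarrow> ('i \<Rightarrow>\<^sub>0 nat) \<Rightarrow> 'k" where
  "monom_val x m = (\<Prod>i\<in>Poly_Mapping.keys m. x i ^ Poly_Mapping.lookup m i)"

lemma monom_val_superset:
  assumes "finite I" "Poly_Mapping.keys m \<subseteq> I"
  shows "monom_val x m = (\<Prod>i\<in>I. x i ^ Poly_Mapping.lookup m i)"
  unfolding monom_val_def using assms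
  by (intro prod.mono_neutral_left) (auto simp: in_keys_iff)

lemma monom_val_add: "monom_val x (m + n) = monom_val x m * monom_val x n"
proof -
  let ?I = "Poly_Mapping.keys m \<union> Poly_Mapping.keys n"
  show ?thesis
    by (subst (1 2 3) monom_val_superset[of ?I])
      (auto simp: lookup_add power_add prod.distrib dest: subsetD[OF keys_add])
qed

lemma eval_mpoly_superset:
  assumes "finite S" "Poly_Mapping.keys F \<subseteq> S"
  shows "eval_mpoly x F = (\<Sum>m\<in>S. of_int (Poly_Mapping.lookup F m) * monom_val x m)"
  unfolding eval_mpoly_def monom_val_def[symmetric] using assms
  by (intro sum.mono_neutral_left) (auto simp: in_keys_iff)

lemma eval_mpoly_0 [simp]: "eval_mpoly x 0 = 0"
  by (simp add: eval_mpoly_def)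

lemma eval_mpoly_add: "eval_mpoly x (F + G) = eval_mpoly x F + eval_mpoly x G"
proof -
  let ?S = "Poly_Mapping.keys F \<union> Poly_Mapping.keys G"
  show ?thesis
    by (subst (1 2 3) eval_mpoly_superset[of ?S])
      (auto simp: lookup_add ring_distribs sum.distrib dest: subsetD[OF keys_add])
qed

lemma eval_mpoly_sum: "eval_mpoly x (sum f A) = (\<Sum>a\<in>A. eval_mpoly x (f a))"
  by (induction A rule: infinite_finite_induct) (auto simp: eval_mpoly_add)

lemma eval_mpoly_single:
  "eval_mpoly x (Poly_Mapping.single m c) = of_int c * monom_val x m"
  by (subst eval_mpoly_superset[of "{m}"]) auto

lemma mpoly_sum_singles:
  fixes F :: "'i int_mpoly"
  shows "F = (\<Sum>m\<in>Poly_Mapping.keys F. Poly_Mapping.single m (Poly_Mapping.lookup F m))"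
  by (rule poly_mapping_eqI)
    (auto simp: lookup_sum lookup_single when_def in_keys_iff)

lemma eval_mpoly_mult: "eval_mpoly x (F * G) = eval_mpoly x F * eval_mpoly x G"
proof -
  have "F * G = (\<Sum>m\<in>Poly_Mapping.keys F. \<Sum>n\<in>Poly_Mapping.keys G.
      Poly_Mapping.single (m + n) (Poly_Mapping.lookup F m * Poly_Mapping.lookup G n))"
    by (subst mpoly_sum_singles[of F], subst mpoly_sum_singles[of G])
      (simp add: sum_product mult_single)
  hence "eval_mpoly x (F * G) = (\<Sum>m\<in>Poly_Mapping.keys F. \<Sum>n\<in>Poly_Mapping.keys G.
      (of_int (Poly_Mapping.lookup F m) * monom_val x m) *
      (of_int (Poly_Mapping.lookup G n) * monom_val x n))"
    by (simp add: eval_mpoly_sum eval_mpoly_single monom_val_add mult_ac)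
  also have "\<dots> = eval_mpoly x F * eval_mpoly x G"
    by (simp add: sum_product eval_mpoly_superset[OF finite_keys subset_refl])
  finally show ?thesis .
qed

lemma eval_mpoly_1 [simp]: "eval_mpoly x 1 = 1"
  using eval_mpoly_single[of x 0 1] by (simp add: monom_val_def)

lemma eval_mpoly_of_int [simp]: "eval_mpoly x (of_int c) = of_int c"
  unfolding single_of_int[symmetric]
  by (simp add: eval_mpoly_single monom_val_def del: single_of_int)

lemma eval_mpoly_var [simp]: "eval_mpoly x (var i) = x i"
  by (simp add: var_def eval_mpoly_single monom_val_def)

lemma eval_mpoly_prod: "eval_mpoly x (prod f A) = (\<Prod>a\<in>A. eval_mpoly x (f a))"
  by (induction A rule: infinite_finite_induct) (auto simp: eval_mpoly_mult)

lemma eval_mpoly_power: "eval_mpoly x (F ^ n) = eval_mpoly x F ^ n"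
  by (induction n) (auto simp: eval_mpoly_mult)

lemma eval_mpoly_det_on: "eval_mpoly x (det_on A M) = det_on A (\<lambda>i j. eval_mpoly x (M i j))"
  by (simp add: det_on_def eval_mpoly_sum eval_mpoly_mult eval_mpoly_prod)

section \<open>Degree bounds for integer polynomials\<close>

definition deg_le :: "'i set \<Rightarrow> nat \<Rightarrow> 'i int_mpoly \<Rightarrow> bool" where
  "deg_le I d F \<longleftrightarrow> (\<forall>m\<in>Poly_Mapping.keys F. Poly_Mapping.keys m \<subseteq> I
     \<and> (\<Sum>i\<in>I. Poly_Mapping.lookup m i) \<le> d)"

lemma deg_le_0 [simp]: "deg_le I d 0"
  by (simp add: deg_le_def)

lemma deg_le_of_int [simp]: "deg_le I d (of_int c)"
  unfolding single_of_int[symmetric] by (simp add: deg_le_def)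

lemma deg_le_1 [simp]: "deg_le I d 1"
  using deg_le_of_int[of I d 1] by simp

lemma deg_le_add: "deg_le I d F \<Longrightarrow> deg_le I d G \<Longrightarrow> deg_le I d (F + G)"
  using keys_add[of F G] by (fastforce simp: deg_le_def)

lemma deg_le_sum: "(\<And>a. a \<in> A \<Longrightarrow> deg_le I d (f a)) \<Longrightarrow> deg_le I d (sum f A)"
  by (induction A rule: infinite_finite_induct) (auto simp: deg_le_add)

lemma deg_le_mult:
  assumes "deg_le I d F" "deg_le I e G"
  shows "deg_le I (d + e) (F * G)"
  unfolding deg_le_def
proof
  fix k assume "k \<in> Poly_Mapping.keys (F * G)"
  then obtain m n where k: "k = m + n" and m: "m \<in> Poly_Mapping.keys F" and n: "n \<in> Poly_Mapping.keys G"
    using keys_mult[of F G] by blast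
  have "Poly_Mapping.keys k \<subseteq> I"
    using assms m n keys_add[of m n] unfolding k deg_le_def by blast
  moreover have "(\<Sum>i\<in>I. Poly_Mapping.lookup k i) \<le> d + e"
    using assms m n by (simp add: k lookup_add sum.distrib deg_le_def add_mono)
  ultimately show "Poly_Mapping.keys k \<subseteq> I \<and> (\<Sum>i\<in>I. Poly_Mapping.lookup k i) \<le> d + e" ..
qed

lemma deg_le_prod: "(\<And>a. a \<in> A \<Longrightarrow> deg_le I (d a) (f a)) \<Longrightarrow> deg_le I (sum d A) (prod f A)"
  by (induction A rule: infinite_finite_induct) (auto simp: deg_le_mult)

lemma deg_le_power: "deg_le I d F \<Longrightarrow> deg_le I (n * d) (F ^ n)"
  by (induction n) (auto simp: deg_le_mult)

lemma deg_le_mono: "deg_le I d F \<Longrightarrow> d \<le> e \<Longrightarrow> deg_le I e F"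
  by (force simp: deg_le_def)

lemma deg_le_var:
  assumes "i \<in> I" "finite I"
  shows "deg_le I 1 (var i)"
  using assms by (auto simp: deg_le_def var_def lookup_single when_def)

section \<open>Fermat's theorem and the Frobenius map\<close>

lemma field_power_card_minus_1:
  fixes x :: "'k::{field,finite}"
  assumes "x \<noteq> 0"
  shows "x ^ (CARD('k) - 1) = 1"
proof -
  have "(\<Prod>y\<in>UNIV - {0::'k}. y) = (\<Prod>y\<in>UNIV - {0}. x * y)"
    by (rule prod.reindex_bij_witness[of _ "\<lambda>y. x * y" "\<lambda>y. y / x"]) (use assms in auto)
  also have "\<dots> = x ^ (CARD('k) - 1) * (\<Prod>y\<in>UNIV - {0::'k}. y)"
    by (simp add: prod.distrib)
  finally show ?thesis by simp
qed

text \<open>Adding 1 to every element permutes the field, hence does not change the sum of all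
  elements.\<close>

lemma of_nat_CARD_eq_0: "of_nat CARD('k) = (0 :: 'k::{field,finite})"
proof -
  have "(\<Sum>t\<in>(UNIV :: 'k set). t) = (\<Sum>t\<in>(UNIV :: 'k set). t + 1)"
    by (rule sum.reindex_bij_witness[of _ "\<lambda>t. t + 1" "\<lambda>t. t - 1"]) auto
  thus ?thesis by (simp add: sum.distrib)
qed

lemma CHAR_eq_of_CARD:
  assumes "CARD('k::{field,finite}) = p ^ s" "prime p"
  shows "CHAR('k) = p"
proof -
  have "CHAR('k) > 0" by (rule finite_imp_CHAR_pos) simp
  hence "prime CHAR('k)" by (rule prime_CHAR_semidom)
  moreover have "CHAR('k) dvd p ^ s"
    using of_nat_CARD_eq_0[where ?'k = 'k] unfolding assms(1) of_nat_eq_0_iff_char_dvd .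
  ultimately show ?thesis using assms(2) prime_dvd_power primes_dvd_imp_eq by blast
qed

lemma add_power_CHAR_power:
  fixes x y :: "'k::idom"
  assumes "CHAR('k) = p" "prime p"
  shows "(x + y) ^ (p ^ j) = x ^ (p ^ j) + y ^ (p ^ j)"
proof (induction j)
  case (Suc j)
  have fd: "(a + b) ^ p = a ^ p + b ^ p" for a b :: 'k
  proof -
    have "(a + b) ^ p = (\<Sum>k\<le>p. of_nat (p choose k) * a ^ k * b ^ (p - k))"
      by (rule binomial_ring)
    also have "\<dots> = (\<Sum>k\<in>{0,p}. of_nat (p choose k) * a ^ k * b ^ (p - k))"
    proof (rule sum.mono_neutral_right)
      show "\<forall>k\<in>{..p} - {0, p}. of_nat (p choose k) * a ^ k * b ^ (p - k) = 0"
        using assms by (auto simp: of_nat_eq_0_iff_char_dvd intro!: dvd_choose_prime)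
    qed auto
    also have "\<dots> = a ^ p + b ^ p" using assms(2) by (auto simp: add.commute)
    finally show ?thesis .
  qed
  have "(x + y) ^ (p ^ Suc j) = ((x + y) ^ (p ^ j)) ^ p" by (simp add: power_mult[symmetric] mult.commute)
  also have "\<dots> = x ^ (p ^ Suc j) + y ^ (p ^ Suc j)"
    by (simp add: Suc fd power_mult[symmetric] mult.commute)
  finally show ?case .
qed simp

lemma sum_power_CHAR_power:
  fixes f :: "'a \<Rightarrow> 'k::idom"
  assumes "CHAR('k) = p" "prime p"
  shows "(\<Sum>a\<in>A. f a) ^ (p ^ j) = (\<Sum>a\<in>A. f a ^ (p ^ j))"
  using assms(2)
  by (induction A rule: infinite_finite_induct)
    (auto simp: add_power_CHAR_power[OF assms] prime_gt_0_nat)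

text \<open>The Frobenius map fixes the prime field: modulo \<open>p\<close> the integer is a sum of
  ones, over which the power distributes. This keeps integer coefficients unchanged in
  \<open>card_zeros_top_coeff\<close>.\<close>

lemma of_int_power_CHAR_power:
  assumes "CHAR('k::idom) = p" "prime p"
  shows "(of_int c :: 'k) ^ (p ^ j) = of_int c"
proof -
  have nat: "(of_nat n :: 'k) ^ (p ^ j) = of_nat n" for n
    using sum_power_CHAR_power[OF assms, of "\<lambda>_. 1" "{..<n}" j] by simp
  define n where "n = nat (c mod int p)"
  have "[c = int n] (mod int p)"
    using prime_gt_0_nat[OF assms(2)] by (simp add: n_def cong_def)
  hence "(of_int c :: 'k) = of_nat n"
    using of_int_eq_iff_cong_CHAR[of c "int n", where ?'a = 'k] assms by simp
  thus ?thesis by (simp add: nat)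
qed

section \<open>Power sums and the Chevalley-Warning theorem\<close>

lemma sum_field_powers:
  assumes "k < CARD('k) - 1"
  shows "(\<Sum>t\<in>UNIV. (t::'k::{field,finite}) ^ k) = 0"
proof (cases "k = 0")
  case True
  thus ?thesis using of_nat_CARD_eq_0[where ?'k = 'k] by simp
next
  case False
  \<comment> \<open>Otherwise all \<open>q - 1\<close> nonzero elements would be roots of a
    polynomial of degree \<open>k < q - 1\<close>. Scaling the summation variable by such a
    \<open>g\<close> then forces the sum to vanish.\<close>
  have "\<exists>g::'k. g \<noteq> 0 \<and> g ^ k \<noteq> 1"
  proof (rule ccontr)
    assume "\<not> ?thesis"
    hence all: "g ^ k = 1" if "g \<noteq> 0" for g :: 'k using that by blast
    let ?P = "Polynomial.monom 1 k - 1 :: 'k poly"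
    have deg: "degree ?P \<le> k"
      by (intro degree_diff_le) (auto simp: degree_monom_le)
    have "coeff ?P k = 1" using False by simp
    hence nz: "?P \<noteq> 0" by fastforce
    have "CARD('k) - 1 = card (UNIV - {0::'k})" by simp
    also have "\<dots> \<le> card {x. poly ?P x = 0}"
      using all by (intro card_mono) (auto simp: poly_monom)
    also have "\<dots> \<le> degree ?P" using nz by (rule card_poly_roots_bound)
    finally show False using deg assms by simp
  qed
  then obtain g :: 'k where g: "g \<noteq> 0" "g ^ k \<noteq> 1" by blast
  have "(\<Sum>t\<in>UNIV. t ^ k) = (\<Sum>t\<in>UNIV. (g * t) ^ k)"
    by (rule sum.reindex_bij_witness[of _ "\<lambda>y. g * y" "\<lambda>y. y / g"]) (use g in auto)
  also have "\<dots> = g ^ k * (\<Sum>t\<in>UNIV. t ^ k)"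
    by (simp add: power_mult_distrib sum_distrib_left)
  finally show ?thesis using g by simp
qed

lemma sum_field_powers_top:
  "(\<Sum>t\<in>UNIV. (t::'k::{field,finite}) ^ (CARD('k) - 1)) = -1"
proof -
  have "CARD('k) > 1" using card_mono[of UNIV "{0,1::'k}"] by simp
  hence "(\<Sum>t\<in>UNIV. (t::'k) ^ (CARD('k) - 1)) = (\<Sum>t\<in>(UNIV :: 'k set). if t = 0 then 0 else 1)"
    by (intro sum.cong) (auto simp: field_power_card_minus_1 simp del: One_nat_def)
  also have "\<dots> = of_nat (CARD('k) - 1)"
    by (subst sum.If_cases) (auto simp: Compl_eq_Diff_UNIV)
  also have "\<dots> = -1"
    using \<open>CARD('k) > 1\<close> of_nat_CARD_eq_0[where ?'k = 'k] by (simp add: of_nat_diff)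
  finally show ?thesis .
qed

lemma sum_monomials_affine:
  assumes "finite I"
  shows "(\<Sum>x\<in>I \<rightarrow>\<^sub>E (UNIV :: 'k::{field,finite} set). \<Prod>i\<in>I. x i ^ k i) = (\<Prod>i\<in>I. \<Sum>t\<in>UNIV. t ^ k i)"
  using assms by (subst prod_sum_PiE) auto

lemma card_zeros_eq_sum:
  fixes F :: "('i \<Rightarrow> 'k) \<Rightarrow> 'k::{field,finite}"
  assumes "finite I"
  shows "of_nat (card {x \<in> I \<rightarrow>\<^sub>E UNIV. F x = 0}) =
    (of_nat CARD('k) ^ card I - (\<Sum>x\<in>I \<rightarrow>\<^sub>E UNIV. F x ^ (CARD('k) - 1)))"
proof -
  let ?X = "I \<rightarrow>\<^sub>E (UNIV :: 'k set)"
  have fin: "finite ?X" using assms by (intro finite_PiE) auto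
  have "CARD('k) > 1" using card_mono[of UNIV "{0,1::'k}"] by simp
  hence "(\<Sum>x\<in>?X. 1 - F x ^ (CARD('k) - 1)) = (\<Sum>x\<in>?X. if F x = 0 then 1 else 0)"
    by (intro sum.cong) (auto simp: field_power_card_minus_1 simp del: One_nat_def)
  also have "\<dots> = of_nat (card {x \<in> ?X. F x = 0})"
    using fin by (subst sum.inter_filter[symmetric]) auto
  also have "(\<Sum>x\<in>?X. 1 - F x ^ (CARD('k) - 1)) = of_nat (card ?X) - (\<Sum>x\<in>?X. F x ^ (CARD('k) - 1))"
    by (simp add: sum_subtractf)
  also have "card ?X = CARD('k) ^ card I" using assms by (simp add: card_PiE)
  finally show ?thesis by simp
qed

text \<open>Each monomial of \<open>F ^ (q - 1)\<close> has total degree below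
  \<open>card I * (q - 1)\<close>, so one of its exponents is below \<open>q - 1\<close>, and
  summing over that coordinate gives 0. With the convention \<open>0 ^ 0 = 1\<close> this includes
  the variables that do not occur.\<close>

lemma chevalley_warning:
  fixes F :: "'i int_mpoly"
  assumes "finite I" "deg_le I d F" "d < card I"
  shows "of_nat (card {x \<in> I \<rightarrow>\<^sub>E (UNIV :: 'k set). eval_mpoly x F = 0}) = (0 :: 'k::{field,finite})"
proof -
  let ?q = "CARD('k)"
  let ?X = "I \<rightarrow>\<^sub>E (UNIV :: 'k set)"
  define H where "H = F ^ (?q - 1)"
  have q: "?q > 1" using card_mono[of UNIV "{0,1::'k}"] by simp
  have deg: "deg_le I ((?q - 1) * d) H" unfolding H_def by (rule deg_le_power[OF assms(2)])
  have "(\<Sum>x\<in>?X. eval_mpoly x F ^ (?q - 1)) = (\<Sum>x\<in>?X. \<Sum>m\<in>Poly_Mapping.keys H.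
      of_int (Poly_Mapping.lookup H m) * (\<Prod>i\<in>I. x i ^ Poly_Mapping.lookup m i))"
  proof (rule sum.cong)
    fix x :: "'i \<Rightarrow> 'k"
    have "eval_mpoly x F ^ (?q - 1) = eval_mpoly x H" by (simp add: H_def eval_mpoly_power)
    also have "\<dots> = (\<Sum>m\<in>Poly_Mapping.keys H.
      of_int (Poly_Mapping.lookup H m) * (\<Prod>i\<in>I. x i ^ Poly_Mapping.lookup m i))"
      unfolding eval_mpoly_superset[OF finite_keys subset_refl]
      using deg by (intro sum.cong arg_cong2[where f = "(*)"] monom_val_superset)
        (auto simp: deg_le_def assms)
    finally show "eval_mpoly x F ^ (?q - 1) = \<dots>" .
  qed simp
  also have "\<dots> = (\<Sum>m\<in>Poly_Mapping.keys H. of_int (Poly_Mapping.lookup H m) *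
      (\<Prod>i\<in>I. \<Sum>t\<in>(UNIV :: 'k set). t ^ Poly_Mapping.lookup m i))"
    by (subst sum.swap) (simp add: sum_distrib_left[symmetric] sum_monomials_affine assms)
  also have "\<dots> = 0"
  proof (rule sum.neutral, rule ballI)
    fix m assume m: "m \<in> Poly_Mapping.keys H"
    have "\<exists>i\<in>I. Poly_Mapping.lookup m i < ?q - 1"
    proof (rule ccontr)
      assume "\<not> ?thesis"
      hence "card I * (?q - 1) \<le> (\<Sum>i\<in>I. Poly_Mapping.lookup m i)"
        using sum_bounded_below[of I "?q - 1" "Poly_Mapping.lookup m"] by force
      also have "\<dots> \<le> (?q - 1) * d" using deg m by (auto simp: deg_le_def)
      finally show False using assms(3) q by (simp add: mult.commute)
    qed
    then obtain i where "i \<in> I" "Poly_Mapping.lookup m i < ?q - 1" by blast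
    hence "(\<Prod>i\<in>I. \<Sum>t\<in>(UNIV :: 'k set). t ^ Poly_Mapping.lookup m i) = 0"
      using assms(1) by (auto simp: prod_zero_iff intro!: bexI[of _ i] sum_field_powers)
    thus "of_int (Poly_Mapping.lookup H m) *
      (\<Prod>i\<in>I. \<Sum>t\<in>(UNIV :: 'k set). t ^ Poly_Mapping.lookup m i) = 0" by simp
  qed
  finally show ?thesis
    using assms by (subst card_zeros_eq_sum) (auto simp: of_nat_CARD_eq_0)
qed

section \<open>The borderline degree over extensions of the prime field\<close>

lemma sum_eq_imp_all_eq:
  fixes f :: "'a \<Rightarrow> nat"
  assumes "finite I" "\<And>i. i \<in> I \<Longrightarrow> c \<le> f i" "sum f I \<le> card I * c" "i \<in> I"
  shows "f i = c"
proof (rule ccontr)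
  assume "f i \<noteq> c"
  hence "c < f i" using assms by (simp add: le_neq_implies_less)
  hence "(\<Sum>i\<in>I. c) < sum f I" using assms by (intro sum_strict_mono_ex1) auto
  thus False using assms by simp
qed

text \<open>Uniqueness of the base-\<open>p\<close> expansion \<open>(p - 1, \<dots>, p - 1)\<close> of \<open>p ^ s - 1\<close>: in every
  coordinate the lowest digit is at least \<open>p - 1\<close>, and the degree bound forces equality.\<close>

lemma top_digits_unique:
  fixes m :: "nat \<Rightarrow> 'i \<Rightarrow> nat"
  assumes "finite I" "p > 1"
    and "\<And>j. j < s \<Longrightarrow> (\<Sum>i\<in>I. m j i) \<le> card I * (p - 1)"
    and "\<And>i. i \<in> I \<Longrightarrow> (\<Sum>j<s. p ^ j * m j i) = p ^ s - 1"
    and "j < s" "i \<in> I"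
  shows "m j i = p - 1"
  using assms(3-)
proof (induction s arbitrary: m j)
  case (Suc s)
  have split: "m 0 i + p * (\<Sum>j<s. p ^ j * m (Suc j) i) = p ^ Suc s - 1" if "i \<in> I" for i
    using Suc.prems(2)[OF that] by (simp add: sum.lessThan_Suc_shift sum_distrib_left mult_ac del: sum.lessThan_Suc)
  have m0: "p - 1 \<le> m 0 i" if "i \<in> I" for i
  proof -
    have "p dvd m 0 i + 1"
    proof -
      have "m 0 i + 1 + p * (\<Sum>j<s. p ^ j * m (Suc j) i) = p * p ^ s"
        using split[OF that] assms(2) by simp
      thus ?thesis by (metis dvd_add_left_iff dvd_triv_left)
    qed
    hence "p \<le> m 0 i + 1" by (auto dest: dvd_imp_le)
    thus ?thesis by simp
  qed
  have m0': "m 0 i = p - 1" if "i \<in> I" for i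
    using sum_eq_imp_all_eq[of I "p - 1" "m 0" i] assms(1) m0 Suc.prems(1)[of 0] that by auto
  show ?case
  proof (cases j)
    case 0
    thus ?thesis using m0' Suc.prems by simp
  next
    case (Suc j')
    have "m (Suc j') i = p - 1"
    proof (rule Suc.IH[of "\<lambda>j. m (Suc j)"])
      fix i assume "i \<in> I"
      have "p * (\<Sum>j<s. p ^ j * m (Suc j) i) = p * (p ^ s - 1)"
        using split[OF \<open>i \<in> I\<close>] m0'[OF \<open>i \<in> I\<close>] assms(2) by (simp add: right_diff_distrib')
      thus "(\<Sum>j<s. p ^ j * m (Suc j) i) = p ^ s - 1" using assms(2) by simp
    qed (use Suc.prems Suc in auto)
    thus ?thesis using Suc by simp
  qed
qed simp

lemma power_minus_1_geometric: "(p::nat) ^ s - 1 = (\<Sum>j<s. p ^ j * (p - 1))"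
proof (induction s)
  case (Suc s)
  have "p ^ Suc s - 1 = (p ^ s - 1) + p ^ s * (p - 1)"
    by (cases "p = 0") (auto simp: right_diff_distrib' power_0_left mult.commute)
  thus ?case by (simp only: Suc.IH sum.lessThan_Suc)
qed simp

text \<open>An integer in which no field occurs: it is the common quantity behind the counts over
  all fields of characteristic \<open>p\<close>.\<close>

definition top_coeff :: "'i set \<Rightarrow> nat \<Rightarrow> 'i int_mpoly \<Rightarrow> int" where
  "top_coeff I p F = Poly_Mapping.lookup (F ^ (p - 1)) (\<Sum>i\<in>I. Poly_Mapping.single i (p - 1))"

text \<open>Expanding the product over \<open>j\<close> selects a monomial \<open>g j\<close> of
  \<open>F ^ (p - 1)\<close> for each digit, and \<open>x i\<close> gets the exponent
  \<open>k g i\<close>. A selection survives the summation only if no exponent is below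
  \<open>q - 1\<close>; the degree bound then makes all of them equal to \<open>q - 1\<close>, and
  uniqueness of digits leaves the constant selection.\<close>

lemma card_zeros_top_coeff:
  fixes F :: "'i int_mpoly"
  assumes "finite I" "I \<noteq> {}" "deg_le I (card I) F" "prime p" "CARD('k) = p ^ s"
  shows "of_nat (card {x \<in> I \<rightarrow>\<^sub>E (UNIV :: 'k set). eval_mpoly x F = 0})
    = (- ((-1) ^ card I * of_int (top_coeff I p F) ^ s) :: 'k::{field,finite})"
proof -
  let ?q = "CARD('k)"
  let ?X = "I \<rightarrow>\<^sub>E (UNIV :: 'k set)"
  let ?l = "Poly_Mapping.lookup"
  define H where "H = F ^ (p - 1)"
  define \<mu> where "\<mu> = (\<Sum>i\<in>I. Poly_Mapping.single i (p - 1))"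
  define a where "a = top_coeff I p F"
  have a: "a = ?l H \<mu>" by (simp add: a_def H_def \<mu>_def top_coeff_def)
  have p: "p > 1" using assms(4) by (rule prime_gt_1_nat)
  have char: "CHAR('k) = p" by (rule CHAR_eq_of_CARD[OF assms(5,4)])
  have deg: "deg_le I (card I * (p - 1)) H"
    unfolding H_def using deg_le_power[OF assms(3), of "p - 1"] by (simp add: mult.commute)
  have l\<mu>: "?l \<mu> i = (if i \<in> I then p - 1 else 0)" for i
    unfolding \<mu>_def using assms(1) by (simp add: lookup_sum lookup_single when_def)
  have k\<mu>: "Poly_Mapping.keys \<mu> \<subseteq> I"
    using p by (auto simp: in_keys_iff l\<mu> split: if_splits)
  \<comment> \<open>\<open>\<mu>\<close> is added even if its coefficient is 0, so that the
    surviving selection always belongs to the index set.\<close>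
  define S where "S = insert \<mu> (Poly_Mapping.keys H)"
  have S: "Poly_Mapping.keys m \<subseteq> I" "(\<Sum>i\<in>I. ?l m i) \<le> card I * (p - 1)" if "m \<in> S" for m
    using that deg k\<mu> by (auto simp: S_def deg_le_def l\<mu>)
  have [simp]: "finite S" by (simp add: S_def)
  define k where "k = (\<lambda>(g :: nat \<Rightarrow> 'i \<Rightarrow>\<^sub>0 nat) i. \<Sum>j<s. p ^ j * ?l (g j) i)"
  have ev: "eval_mpoly x F ^ (?q - 1) = (\<Sum>g\<in>{..<s} \<rightarrow>\<^sub>E S. of_int (\<Prod>j<s. ?l H (g j)) * (\<Prod>i\<in>I. x i ^ k g i))"
    for x :: "'i \<Rightarrow> 'k"
  proof -
    have "eval_mpoly x F ^ (?q - 1) = (\<Prod>j<s. eval_mpoly x F ^ (p ^ j * (p - 1)))"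
      unfolding assms(5) power_minus_1_geometric by (rule power_sum)
    also have "\<dots> = (\<Prod>j<s. (\<Sum>m\<in>S. of_int (?l H m) * monom_val x m) ^ (p ^ j))"
    proof (intro prod.cong refl)
      fix j
      have "eval_mpoly x H = (\<Sum>m\<in>S. of_int (?l H m) * monom_val x m)"
        by (rule eval_mpoly_superset) (auto simp: S_def)
      moreover have "eval_mpoly x F ^ (p ^ j * (p - 1)) = eval_mpoly x H ^ (p ^ j)"
        unfolding H_def eval_mpoly_power power_mult[symmetric] by (subst mult.commute) (rule refl)
      ultimately show "eval_mpoly x F ^ (p ^ j * (p - 1)) = (\<Sum>m\<in>S. of_int (?l H m) * monom_val x m) ^ (p ^ j)"
        by (simp only:)
    qed
    also have "\<dots> = (\<Prod>j<s. \<Sum>m\<in>S. of_int (?l H m) * (\<Prod>i\<in>I. x i ^ (p ^ j * ?l m i)))"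
    proof (intro prod.cong refl)
      fix j
      have "(\<Sum>m\<in>S. of_int (?l H m) * monom_val x m) ^ (p ^ j)
         = (\<Sum>m\<in>S. (of_int (?l H m) * monom_val x m) ^ (p ^ j))"
        by (rule sum_power_CHAR_power[OF char assms(4)])
      also have "\<dots> = (\<Sum>m\<in>S. of_int (?l H m) * (\<Prod>i\<in>I. x i ^ (p ^ j * ?l m i)))"
      proof (intro sum.cong refl)
        fix m assume "m \<in> S"
        show "(of_int (?l H m) * monom_val x m) ^ (p ^ j) = of_int (?l H m) * (\<Prod>i\<in>I. x i ^ (p ^ j * ?l m i))"
          unfolding power_mult_distrib of_int_power_CHAR_power[OF char assms(4)]
            monom_val_superset[OF assms(1) S(1)[OF \<open>m \<in> S\<close>]]
          by (simp add: prod_power_distrib power_mult[symmetric] mult.commute)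
      qed
      finally show "(\<Sum>m\<in>S. of_int (?l H m) * monom_val x m) ^ (p ^ j)
         = (\<Sum>m\<in>S. of_int (?l H m) * (\<Prod>i\<in>I. x i ^ (p ^ j * ?l m i)))" .
    qed
    also have "\<dots> = (\<Sum>g\<in>{..<s} \<rightarrow>\<^sub>E S. \<Prod>j<s. of_int (?l H (g j)) * (\<Prod>i\<in>I. x i ^ (p ^ j * ?l (g j) i)))"
      by (rule prod_sum_PiE) auto
    also have "\<dots> = (\<Sum>g\<in>{..<s} \<rightarrow>\<^sub>E S. of_int (\<Prod>j<s. ?l H (g j)) * (\<Prod>i\<in>I. x i ^ k g i))"
      by (simp add: prod.distrib k_def power_sum prod.swap[of _ I])
    finally show ?thesis .
  qed
  let ?g = "\<lambda>j\<in>{..<s}. \<mu>"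
  let ?T = "\<lambda>g. of_int (\<Prod>j<s. ?l H (g j)) * (\<Prod>i\<in>I. \<Sum>t\<in>(UNIV :: 'k set). t ^ k g i)"
  have kg: "k ?g i = ?q - 1" if "i \<in> I" for i
    unfolding assms(5) power_minus_1_geometric using that by (auto simp: k_def l\<mu>)
  have "(\<Sum>x\<in>?X. eval_mpoly x F ^ (?q - 1)) = (\<Sum>g\<in>{..<s} \<rightarrow>\<^sub>E S. ?T g)"
    unfolding ev by (subst sum.swap) (simp add: sum_distrib_left[symmetric] sum_monomials_affine assms)
  also have "\<dots> = (\<Sum>g\<in>{?g}. ?T g)"
  proof (rule sum.mono_neutral_right)
    show "\<forall>g\<in>({..<s} \<rightarrow>\<^sub>E S) - {?g}. ?T g = 0"
    proof
      fix g assume g: "g \<in> ({..<s} \<rightarrow>\<^sub>E S) - {?g}"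
      have gS: "g j \<in> S" if "j < s" for j using g that by auto
      have "\<exists>i\<in>I. k g i < ?q - 1"
      proof (rule ccontr)
        assume "\<not> ?thesis"
        hence ge: "?q - 1 \<le> k g i" if "i \<in> I" for i using that by force
        have "sum (k g) I = (\<Sum>j<s. p ^ j * (\<Sum>i\<in>I. ?l (g j) i))"
          unfolding k_def by (subst sum.swap) (simp add: sum_distrib_left)
        also have "\<dots> \<le> (\<Sum>j<s. p ^ j * (card I * (p - 1)))"
          using S(2)[OF gS] by (intro sum_mono mult_left_mono) auto
        also have "\<dots> = card I * (?q - 1)"
          unfolding assms(5) power_minus_1_geometric by (simp add: sum_distrib_left mult_ac)
        finally have "k g i = p ^ s - 1" if "i \<in> I" for i
          using sum_eq_imp_all_eq[of I "?q - 1" "k g" i] ge that assms(1,5) by auto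
        hence "?l (g j) i = p - 1" if "j < s" "i \<in> I" for i j
          using top_digits_unique[of I p s "\<lambda>j. ?l (g j)" j i] assms(1) p S(2)[OF gS] that
          by (auto simp: k_def)
        hence "g j = \<mu>" if "j < s" for j
          using S(1)[OF gS[OF that]] that by (intro poly_mapping_eqI) (auto simp: l\<mu> in_keys_iff)
        hence "g = ?g" using g by (intro ext) (auto simp: PiE_def extensional_def)
        thus False using g by simp
      qed
      then obtain i where "i \<in> I" "k g i < ?q - 1" by blast
      hence "(\<Prod>i\<in>I. \<Sum>t\<in>(UNIV :: 'k set). t ^ k g i) = 0"
        using assms(1) by (auto simp: prod_zero_iff intro!: bexI[of _ i] sum_field_powers)
      thus "?T g = 0" by simp
    qed
  qed (auto simp: S_def intro!: finite_PiE)
  also have "\<dots> = of_int a ^ s * (-1) ^ card I"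
    by (simp add: a kg sum_field_powers_top del: One_nat_def)
  finally have sum: "(\<Sum>x\<in>?X. eval_mpoly x F ^ (?q - 1)) = of_int a ^ s * (-1) ^ card I" .
  have "card I \<noteq> 0" using assms by simp
  thus ?thesis
    unfolding card_zeros_eq_sum[OF assms(1)] sum by (simp add: of_nat_CARD_eq_0 a_def mult.commute)
qed

section \<open>Minors at a cut\<close>

lemma transpose_image_insert:
  assumes "a \<notin> X" "b \<notin> X"
  shows "transpose a b ` insert a X = insert b X"
proof -
  have "transpose a b ` X = (\<lambda>x. x) ` X"
    using assms by (intro image_cong) (auto simp: transpose_def)
  thus ?thesis by simp
qed

text \<open>\<open>D p r\<close> uses the row of \<open>p\<close> and the column of \<open>r\<close>
  in place of those of \<open>a\<close>. Since \<open>z\<close> pairs to 1 with both rows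
  \<open>a\<close> and \<open>b\<close>, their difference is annihilated by \<open>z\<close>, like
  all rows in \<open>S\<close>; so \<open>D\<close> takes the same value for \<open>a\<close> and
  \<open>b\<close> in its first argument, and by symmetry in its second.\<close>

lemma det_on_cut_single:
  fixes K :: "'a \<Rightarrow> 'a \<Rightarrow> 'r::idom"
  assumes "finite S" "a \<notin> S" "b \<notin> S" and sym: "\<And>i j. K i j = K j i"
    and z: "\<And>i. i \<in> S \<Longrightarrow> (\<Sum>j\<in>S. K i j * z j) = 0"
    and za: "(\<Sum>j\<in>S. K a j * z j) = 1" and zb: "(\<Sum>j\<in>S. K b j * z j) = 1"
  shows "det_on (insert a S) K = det_on (insert b S) K"
proof (cases "a = b")
  case False
  let ?T = "insert a S"
  let ?\<rho> = "\<lambda>p i. if i = a then p else i"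
  define D where "D = (\<lambda>p r. det_on ?T (\<lambda>i j. K (?\<rho> p i) (?\<rho> r j)))"
  have D_sym: "D p r = D r p" for p r
    unfolding D_def using assms(1) sym
    by (subst det_on_transpose[symmetric]) (auto intro!: det_on_cong)
  obtain k where k: "k \<in> S" "z k \<noteq> 0"
    using za by (metis (no_types, lifting) mult_zero_right sum.neutral zero_neq_one)
  have D_row: "D a r = D b r" for r
  proof -
    let ?M = "\<lambda>i j. K i (?\<rho> r j)"
    have "det_on ?T (?M(a := \<lambda>j. ?M a j - ?M b j)) = 0"
    proof (rule det_on_null_vector[where z = "\<lambda>j. if j = a then 0 else z j" and k = k])
      fix i assume "i \<in> ?T"
      have "(\<Sum>j\<in>?T. (?M(a := \<lambda>j. ?M a j - ?M b j)) i j * (if j = a then 0 else z j))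
        = (\<Sum>j\<in>S. (if i = a then K a j - K b j else K i j) * z j)"
        using assms(1,2) by (auto intro!: sum.cong)
      also have "\<dots> = 0"
        using \<open>i \<in> ?T\<close> z za zb
        by (cases "i = a") (simp_all add: left_diff_distrib sum_subtractf)
      finally show "(\<Sum>j\<in>?T. (?M(a := \<lambda>j. ?M a j - ?M b j)) i j * (if j = a then 0 else z j)) = 0" .
    qed (use assms k in auto)
    moreover have "det_on ?T (?M(a := \<lambda>j. ?M a j - ?M b j))
      = det_on ?T (?M(a := ?M a)) - det_on ?T (?M(a := ?M b))"
      using assms(1) by (intro det_on_row_diff) auto
    moreover have "det_on ?T (?M(a := ?M p)) = D p r" for p
      unfolding D_def by (rule det_on_cong) auto
    ultimately show ?thesis by simp
  qed
  have "det_on ?T K = D a a" unfolding D_def by (rule det_on_cong) auto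
  also have "\<dots> = D b b" using D_row[of a] D_sym[of b a] D_row[of b] by simp
  also have "D b b = det_on ?T (\<lambda>i j. K (transpose a b i) (transpose a b j))"
    unfolding D_def using assms(3) by (intro det_on_cong arg_cong2[where f = K]) (auto simp: transpose_def)
  also have "\<dots> = det_on (transpose a b ` ?T) K"
    by (rule det_on_relabel[symmetric]) (use assms(1) in simp)
  also have "transpose a b ` ?T = insert b S"
    using assms(2,3) by (rule transpose_image_insert)
  finally show ?thesis .
qed simp

text \<open>\<open>D p q r s\<close> puts the rows \<open>p, q\<close> and the columns
  \<open>r, s\<close> in the places of \<open>e1, e2\<close>. With the differences
  \<open>e3 - e1\<close> and \<open>e2 - e3\<close> as rows, \<open>z\<close> is a null vector;
  expanding both gives \<open>D_row\<close>, as \<open>D e3 e3\<close> has equal rows. Using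
  \<open>D_row\<close> on rows and on columns yields the quadratic expression, whose mixed terms
  agree by symmetry.\<close>

lemma det_on_cut_pair:
  fixes K :: "'a \<Rightarrow> 'a \<Rightarrow> 'r::idom"
  assumes "finite S" "e1 \<notin> S" "e2 \<notin> S" "e3 \<notin> S" "e1 \<noteq> e2" "e1 \<noteq> e3" "e2 \<noteq> e3"
    and sym: "\<And>i j. K i j = K j i"
    and z: "\<And>i. i \<in> S \<Longrightarrow> (\<Sum>j\<in>S. K i j * z j) = 0"
    and ze: "\<And>e. e \<in> {e1, e2, e3} \<Longrightarrow> (\<Sum>j\<in>S. K e j * z j) = 1"
  shows "det_on (insert e2 (insert e3 S)) K = det_on (insert e1 (insert e2 S)) K
    + det_on (insert e1 (insert e3 S)) K
    - 2 * det_on (insert e1 (insert e2 S)) (\<lambda>i j. K i (if j = e2 then e3 else j))"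
proof -
  let ?T = "insert e1 (insert e2 S)"
  let ?\<rho> = "\<lambda>p q i. if i = e1 then p else if i = e2 then q else i"
  define D where "D = (\<lambda>p q r s. det_on ?T (\<lambda>i j. K (?\<rho> p q i) (?\<rho> r s j)))"
  have fin: "finite ?T" using assms by simp
  have D_sym: "D p q r s = D r s p q" for p q r s
    unfolding D_def using fin sym
    by (subst det_on_transpose[symmetric]) (auto intro!: det_on_cong)
  obtain k where k: "k \<in> S" "z k \<noteq> 0"
    using ze[of e1] by (metis (no_types, lifting) mult_zero_right sum.neutral zero_neq_one insertI1)
  have D_row: "D e3 e2 r s = D e1 e2 r s - D e1 e3 r s" for r s
  proof -
    let ?M = "\<lambda>i j. K i (?\<rho> r s j)"
    have DM: "det_on ?T (?M(e2 := ?M q, e1 := ?M p)) = D p q r s" for p q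
      unfolding D_def using assms by (intro det_on_cong) auto
    have DM': "det_on ?T (?M(e1 := ?M p, e2 := ?M q)) = D p q r s" for p q
      unfolding D_def using assms by (intro det_on_cong) auto
    let ?d = "\<lambda>j. ?M e3 j - ?M e1 j" and ?d' = "\<lambda>j. ?M e2 j - ?M e3 j"
    let ?N = "?M(e2 := ?d', e1 := ?d)"
    let ?z = "\<lambda>j. if j \<in> S then z j else 0"
    have "det_on ?T ?N = 0"
    proof (rule det_on_null_vector[where z = ?z and k = k])
      fix i assume i: "i \<in> ?T"
      have "(\<Sum>j\<in>?T. ?N i j * ?z j)
        = (\<Sum>j\<in>S. (if i = e1 then K e3 j - K e1 j else if i = e2 then K e2 j - K e3 j else K i j) * z j)"
        using assms(1-7) by (intro sum.mono_neutral_cong_right) auto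
      also have "\<dots> = 0"
        using i z ze assms(5)
        by (cases "i = e1"; cases "i = e2") (simp_all add: left_diff_distrib sum_subtractf)
      finally show "(\<Sum>j\<in>?T. ?N i j * ?z j) = 0" .
    qed (use assms k in auto)
    moreover have "det_on ?T ?N = det_on ?T (?M(e2 := ?d', e1 := ?M e3)) - det_on ?T (?M(e2 := ?d', e1 := ?M e1))"
      using fin by (intro det_on_row_diff) auto
    moreover have "det_on ?T (?M(e2 := ?d', e1 := ?M p)) = D p e2 r s - D p e3 r s" for p
    proof -
      have "det_on ?T (?M(e2 := ?d', e1 := ?M p)) = det_on ?T (?M(e1 := ?M p, e2 := ?d'))"
        by (rule arg_cong[where f = "det_on ?T"], rule fun_upd_twist) (use assms(5) in simp)
      also have "\<dots> = det_on ?T (?M(e1 := ?M p, e2 := ?M e2)) - det_on ?T (?M(e1 := ?M p, e2 := ?M e3))"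
        using fin by (intro det_on_row_diff) auto
      also have "\<dots> = D p e2 r s - D p e3 r s"
        using DM'[of p e2] DM'[of p e3] by (rule arg_cong2)
      finally show ?thesis .
    qed
    moreover have "D e3 e3 r s = 0"
      unfolding D_def using fin assms(5) by (intro det_on_equal_rows[of _ e1 e2]) auto
    ultimately show ?thesis by (simp add: algebra_simps)
  qed
  have "transpose e1 e3 ` insert e1 (insert e2 S) = insert e3 (insert e2 S)"
    using assms(2-7) by (intro transpose_image_insert) auto
  hence "det_on (insert e2 (insert e3 S)) K = det_on (transpose e1 e3 ` ?T) K"
    by (simp only: insert_commute[of e3 e2 S])
  also have "\<dots> = D e3 e2 e3 e2"
    unfolding det_on_relabel[OF fin] D_def using assms(2-7)
    by (intro det_on_cong arg_cong2[where f = K]) (auto simp: transpose_def)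
  also have "\<dots> = D e1 e2 e1 e2 + D e1 e3 e1 e3 - 2 * D e1 e2 e1 e3"
    by (simp add: D_row D_sym[of e1 e2 e3 e2] D_sym[of e1 e3 e3 e2] D_sym[of e1 e3 e1 e2])
  also have "D e1 e2 e1 e2 = det_on ?T K"
    unfolding D_def by (rule det_on_cong) auto
  also have "D e1 e3 e1 e3 = det_on (transpose e2 e3 ` ?T) K"
    unfolding det_on_relabel[OF fin] D_def using assms(2-7)
    by (intro det_on_cong arg_cong2[where f = K]) (auto simp: transpose_def)
  also have "transpose e2 e3 ` ?T = insert e1 (insert e3 S)"
    unfolding insert_commute[of e1 e2 S] insert_commute[of e1 e3 S]
    using assms(2-7) by (intro transpose_image_insert) auto
  also have "D e1 e2 e1 e3 = det_on ?T (\<lambda>i j. K i (if j = e2 then e3 else j))"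
    unfolding D_def using assms(5) by (intro det_on_cong) auto
  finally show ?thesis .
qed

lemma det_on_symmetric_jacobi:
  assumes "finite S" "e2 \<notin> S" "e3 \<notin> S" "e2 \<noteq> e3" and sym: "\<And>i j. K i j = K j i"
  shows "det_on (insert e2 (insert e3 S)) K * det_on S K
    = det_on (insert e2 S) K * det_on (insert e3 S) K
      - det_on (insert e2 S) (\<lambda>i j. K i (if j = e2 then e3 else j)) ^ 2"
proof -
  have "det_on (insert e2 S) (K(e2 := K e3)) = det_on (insert e2 S) (\<lambda>i j. (K(e2 := K e3)) j i)"
    using assms(1) by (intro det_on_transpose[symmetric]) auto
  also have "\<dots> = det_on (insert e2 S) (\<lambda>i j. K i (if j = e2 then e3 else j))"
    using sym by (intro det_on_cong) auto
  finally show ?thesis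
    using det_on_jacobi[OF assms(1-4), of K] by (simp add: power2_eq_square)
qed

text \<open>Only fixed points of the permutation contribute to the degree, and they lie in
  \<open>E\<close>. A nonzero product maps \<open>W\<close> injectively into \<open>E\<close>, and
  no image of an element of \<open>W\<close> is itself fixed, so \<open>card W\<close> elements of
  \<open>E\<close> are lost.\<close>

lemma deg_le_det_on:
  fixes M :: "'a \<Rightarrow> 'a \<Rightarrow> 'i int_mpoly"
  assumes "finite E" "finite W" "E \<inter> W = {}"
    and zero: "\<And>i j. i \<in> W \<Longrightarrow> j \<in> W \<Longrightarrow> M i j = 0"
    and offdiag: "\<And>i j. i \<in> E \<union> W \<Longrightarrow> j \<in> E \<union> W \<Longrightarrow> i \<noteq> j \<Longrightarrow> deg_le I 0 (M i j)"
    and diag: "\<And>i. i \<in> E \<Longrightarrow> deg_le I 1 (M i i)"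
  shows "deg_le I (card E - card W) (det_on (E \<union> W) M)"
  unfolding det_on_def
proof (rule deg_le_sum)
  let ?A = "E \<union> W"
  fix \<pi> assume "\<pi> \<in> {\<pi>. \<pi> permutes ?A}"
  hence p: "\<pi> permutes ?A" by simp
  have inj: "inj \<pi>" by (rule permutes_inj[OF p])
  have "deg_le I (card E - card W) (\<Prod>i\<in>?A. M i (\<pi> i))"
  proof (cases "\<pi> ` W \<subseteq> E")
    case True
    let ?d = "\<lambda>i. if \<pi> i = i then 1 else 0 :: nat"
    have "deg_le I (sum ?d ?A) (\<Prod>i\<in>?A. M i (\<pi> i))"
    proof (rule deg_le_prod)
      fix i assume i: "i \<in> ?A"
      show "deg_le I (?d i) (M i (\<pi> i))"
        using offdiag[of i "\<pi> i"] diag[of i] zero[of i i] i permutes_in_image[OF p, of i] by auto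
    qed
    moreover have "sum ?d ?A \<le> card E - card W"
    proof -
      have "sum ?d ?A = card {i \<in> ?A. \<pi> i = i}"
        using assms by (simp add: sum.If_cases Int_def)
      also have "\<dots> \<le> card (E - \<pi> ` W)"
      proof (rule card_mono)
        show "{i \<in> ?A. \<pi> i = i} \<subseteq> E - \<pi> ` W"
        proof
          fix i assume "i \<in> {i \<in> ?A. \<pi> i = i}"
          hence i: "i \<in> ?A" "\<pi> i = i" by auto
          have "i \<notin> W" using True i assms(3) by force
          moreover have "i \<notin> \<pi> ` W" using calculation i inj by (metis imageE injD)
          ultimately show "i \<in> E - \<pi> ` W" using i by auto
        qed
      qed (use assms in auto)
      also have "\<dots> = card E - card W"
        using True assms by (subst card_Diff_subset) (auto simp: card_image inj_on_subset[OF inj])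
      finally show ?thesis .
    qed
    ultimately show ?thesis by (rule deg_le_mono)
  next
    case False
    then obtain w where "w \<in> W" "\<pi> w \<in> W" using permutes_in_image[OF p] by blast
    hence "(\<Prod>i\<in>?A. M i (\<pi> i)) = 0" using assms by (intro prod_zero) auto
    thus ?thesis by simp
  qed
  thus "deg_le I (card E - card W) (of_int (sign \<pi>) * (\<Prod>i\<in>?A. M i (\<pi> i)))"
    using deg_le_mult[of I 0 "of_int (sign \<pi>)"] by fastforce
qed

section \<open>Incidence matrices\<close>

text \<open>Rows and columns are indexed by edges and (non-root) vertices. Only the edges in \<open>I\<close> carry
  their variable on the diagonal; the other variables are set to zero, which contracts these edges.\<close>

definition inc_mat :: "('e \<Rightarrow> 'v \<Rightarrow> int) \<Rightarrow> 'e set \<Rightarrow> ('e \<Rightarrow> 'r::comm_ring_1) \<Rightarrow> 'e + 'v \<Rightarrow> 'e + 'v \<Rightarrow> 'r"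
  where "inc_mat b I x i j = (case i of
      Inl e \<Rightarrow> (case j of Inl e' \<Rightarrow> if e = e' \<and> e \<in> I then x e else 0 | Inr w \<Rightarrow> of_int (b e w))
    | Inr w \<Rightarrow> (case j of Inl e \<Rightarrow> of_int (b e w) | Inr w' \<Rightarrow> 0))"

text \<open>Edges outside \<open>T\<close> are deleted and edges in \<open>T - I\<close> contracted:
  up to sign this is the Kirchhoff polynomial of a graph minor, as \<open>eval_kirchhoff\<close>
  shows for \<open>T = I = E\<close>.\<close>

definition inc_det :: "('e \<Rightarrow> 'v \<Rightarrow> int) \<Rightarrow> 'v set \<Rightarrow> 'e set \<Rightarrow> 'e set \<Rightarrow> ('e \<Rightarrow> 'r::comm_ring_1) \<Rightarrow> 'r"
  where "inc_det b W T I x = det_on (Inl ` T \<union> Inr ` W) (inc_mat b I x)"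

text \<open>A Dodgson polynomial: its rows and columns are given by edge sets that differ in one
  edge, \<open>e\<close> for the rows and \<open>e'\<close> for the columns.\<close>

definition inc_minor ::
    "('e \<Rightarrow> 'v \<Rightarrow> int) \<Rightarrow> 'v set \<Rightarrow> 'e set \<Rightarrow> 'e set \<Rightarrow> 'e \<Rightarrow> 'e \<Rightarrow> ('e \<Rightarrow> 'r::comm_ring_1) \<Rightarrow> 'r"
  where "inc_minor b W T I e e' x =
    det_on (Inl ` T \<union> Inr ` W) (\<lambda>i j. inc_mat b I x i (if j = Inl e then Inl e' else j))"

lemma inc_mat_simps [simp]:
  "inc_mat b I x (Inl e) (Inl e') = (if e = e' \<and> e \<in> I then x e else 0)"
  "inc_mat b I x (Inl e) (Inr w) = of_int (b e w)"
  "inc_mat b I x (Inr w) (Inl e) = of_int (b e w)"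
  "inc_mat b I x (Inr w) (Inr w') = 0"
  by (simp_all add: inc_mat_def)

lemma inc_mat_sym: "inc_mat b I x i j = inc_mat b I x j i"
  by (cases i; cases j) auto

lemma inc_mat_cong:
  assumes "\<And>e. e \<in> I \<Longrightarrow> x e = y e"
  shows "inc_mat b I x = inc_mat b I y"
  by (intro ext, rename_tac i j, case_tac i; case_tac j) (use assms in auto)

lemma inc_det_cong:
  assumes "\<And>e. e \<in> I \<Longrightarrow> x e = y e"
  shows "inc_det b W T I x = inc_det b W T I y"
  using inc_mat_cong[of I x y b] assms by (simp add: inc_det_def)

text \<open>Deletion-contraction: the coefficient of \<open>x e\<close> belongs to the graph without
  \<open>e\<close>, the remainder to the one with \<open>e\<close> contracted.\<close>

lemma inc_det_insert:
  assumes "finite T" "finite W" "e \<notin> T" "e \<notin> I"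
  shows "inc_det b W (insert e T) (insert e I) x = x e * inc_det b W T I x + inc_det b W (insert e T) I x"
proof -
  let ?A = "Inl ` T \<union> Inr ` W" and ?M = "inc_mat b I x"
  have "inc_det b W (insert e T) (insert e I) x
      = det_on (insert (Inl e) ?A) (?M(Inl e := (?M (Inl e))(Inl e := ?M (Inl e) (Inl e) + x e)))"
    unfolding inc_det_def image_insert Un_insert_left
  proof (rule det_on_cong)
    fix i j
    show "inc_mat b (insert e I) x i j = (?M(Inl e := (?M (Inl e))(Inl e := ?M (Inl e) (Inl e) + x e))) i j"
      using assms(4) by (cases i; cases j) auto
  qed
  also have "\<dots> = x e * det_on ?A ?M + det_on (insert (Inl e) ?A) ?M"
    using assms by (intro det_on_diag_shift) auto
  finally show ?thesis by (simp add: inc_det_def)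
qed

text \<open>Evaluating at the formal variables \<open>var\<close> turns \<open>inc_det\<close> into a polynomial.\<close>

lemma eval_inc_mat: "eval_mpoly x (inc_mat b I var i j) = inc_mat b I x i j"
  by (cases i; cases j) auto

lemma eval_inc_det: "eval_mpoly x (inc_det b W T I var) = inc_det b W T I x"
  by (simp add: inc_det_def eval_mpoly_det_on eval_inc_mat)

lemma eval_inc_minor: "eval_mpoly x (inc_minor b W T I e e' var) = inc_minor b W T I e e' x"
  by (simp add: inc_minor_def eval_mpoly_det_on eval_inc_mat)

lemma deg_le_inc_det:
  assumes "finite T" "finite W" "finite I"
  shows "deg_le I (card T - card W) (inc_det b W T I var)"
proof -
  have "deg_le I (card (Inl ` T :: ('a + 'b) set) - card (Inr ` W :: ('a + 'b) set))
      (det_on (Inl ` T \<union> Inr ` W) (inc_mat b I var))"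
    by (rule deg_le_det_on) (use assms in \<open>auto split: if_splits intro: deg_le_var[simplified]\<close>)
  thus ?thesis by (simp add: inc_det_def card_image)
qed

lemma deg_le_inc_minor:
  assumes "finite T" "finite W" "finite I" "e' \<notin> T"
  shows "deg_le I (card T - card W) (inc_minor b W T I e e' var)"
proof -
  have "deg_le I (card (Inl ` T :: ('a + 'b) set) - card (Inr ` W :: ('a + 'b) set))
      (det_on (Inl ` T \<union> Inr ` W) (\<lambda>i j. inc_mat b I var i (if j = Inl e then Inl e' else j)))"
    by (rule deg_le_det_on) (use assms in \<open>auto split: if_splits intro: deg_le_var[simplified]\<close>)
  thus ?thesis by (simp add: inc_minor_def card_image)
qed

text \<open>If \<open>cut_vec b W y\<close> vanishes on \<open>T\<close>, then \<open>y\<close>, extended by zero to the edges, is a null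
  vector of the matrix.\<close>

definition cut_vec :: "('e \<Rightarrow> 'v \<Rightarrow> int) \<Rightarrow> 'v set \<Rightarrow> ('v \<Rightarrow> int) \<Rightarrow> 'e \<Rightarrow> int" where
  "cut_vec b W y e = (\<Sum>w\<in>W. b e w * y w)"

lemma inc_mat_cut_vec:
  assumes "finite T" "finite W"
  shows "(\<Sum>j\<in>Inl ` T \<union> Inr ` W. inc_mat b I x i j * (case j of Inl _ \<Rightarrow> 0 | Inr w \<Rightarrow> of_int (y w)))
    = (case i of Inl e \<Rightarrow> of_int (cut_vec b W y e) | Inr _ \<Rightarrow> 0)"
proof -
  have "(\<Sum>j\<in>Inl ` T \<union> Inr ` W. inc_mat b I x i j * (case j of Inl _ \<Rightarrow> 0 | Inr w \<Rightarrow> of_int (y w)))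
      = (\<Sum>w\<in>W. inc_mat b I x i (Inr w) * of_int (y w))"
    using assms by (subst sum.union_disjoint) (auto simp: sum.reindex)
  also have "\<dots> = (case i of Inl e \<Rightarrow> of_int (cut_vec b W y e) | Inr _ \<Rightarrow> 0)"
    by (cases i) (auto simp: cut_vec_def)
  finally show ?thesis .
qed

lemma inc_det_null:
  fixes x :: "'e \<Rightarrow> 'k::idom"
  assumes "finite T" "finite W" "\<And>e. e \<in> T \<Longrightarrow> (of_int (cut_vec b W y e) :: 'k) = 0"
    and "w \<in> W" "(of_int (y w) :: 'k) \<noteq> 0"
  shows "inc_det b W T I x = 0"
  unfolding inc_det_def
  by (rule det_on_null_vector[where z = "\<lambda>j. case j of Inl _ \<Rightarrow> 0 | Inr w \<Rightarrow> of_int (y w)" and k = "Inr w"])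
    (use assms in \<open>auto simp: inc_mat_cut_vec[OF assms(1,2)] split: sum.splits\<close>)

lemma cut_vec_nonzero:
  assumes "(of_int (cut_vec b W y e) :: 'k::ring_1) \<noteq> 0"
  obtains w where "w \<in> W" "(of_int (y w) :: 'k) \<noteq> 0"
proof -
  have "\<exists>w\<in>W. (of_int (y w) :: 'k) \<noteq> 0"
  proof (rule ccontr)
    assume "\<not> ?thesis"
    hence "(of_int (cut_vec b W y e) :: 'k) = 0" by (simp add: cut_vec_def)
    thus False using assms by simp
  qed
  thus thesis using that by blast
qed

text \<open>For \<open>y\<close> the indicator of one side of a cut, a single edge across the cut is
  a bridge, and it does not matter which one it is.\<close>

lemma inc_det_star_eq:
  fixes x :: "'e \<Rightarrow> 'k::idom"
  assumes "finite T" "finite W" "\<And>e. e \<in> T \<Longrightarrow> cut_vec b W y e = 0"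
    and "e \<notin> T" "e' \<notin> T" "cut_vec b W y e = 1" "cut_vec b W y e' = 1"
  shows "inc_det b W (insert e T) I x = inc_det b W (insert e' T) I x"
  unfolding inc_det_def image_insert Un_insert_left
  by (rule det_on_cut_single[where z = "\<lambda>j. case j of Inl _ \<Rightarrow> 0 | Inr w \<Rightarrow> of_int (y w)"])
    (use assms in \<open>auto simp: inc_mat_cut_vec[OF assms(1,2)] intro: inc_mat_sym split: sum.splits\<close>)

lemma inc_det_star2:
  fixes x :: "'e \<Rightarrow> 'k::idom"
  assumes "finite T" "finite W" "\<And>e. e \<in> T \<Longrightarrow> cut_vec b W y e = 0"
    and "e1 \<notin> T \<union> I" "e2 \<notin> T \<union> I" "e1 \<noteq> e2"
    and "cut_vec b W y e1 = 1" "cut_vec b W y e2 = 1"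
  shows "inc_det b W (insert e1 (insert e2 T)) (insert e1 (insert e2 I)) x
    = inc_det b W (insert e1 T) I x * (x e1 + x e2) + inc_det b W (insert e1 (insert e2 T)) I x"
proof -
  obtain w where w: "w \<in> W" "(of_int (y w) :: 'k) \<noteq> 0"
    by (rule cut_vec_nonzero[of b W y e1]) (use assms in auto)
  have "inc_det b W T I x = 0"
    using w assms(1-3) by (intro inc_det_null[where y = y]) auto
  moreover have "inc_det b W (insert e2 T) I x = inc_det b W (insert e1 T) I x"
    using assms by (intro inc_det_star_eq) auto
  ultimately show ?thesis
    using assms inc_det_insert[of "insert e1 T" W e2 I b x] by (simp add: inc_det_insert insert_commute[of e2 e1] algebra_simps)
qed

text \<open>The product of all three variables has coefficient 0, as nothing crosses the cut any
  more. The lemma serves the root with \<open>y\<close> constantly 1, and any other vertex with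
  \<open>y\<close> its indicator.\<close>

lemma inc_det_star3:
  fixes x :: "'e \<Rightarrow> 'k::idom"
  assumes "finite T" "finite W" "\<And>e. e \<in> T \<Longrightarrow> cut_vec b W y e = 0"
    and "e1 \<notin> T \<union> I" "e2 \<notin> T \<union> I" "e3 \<notin> T \<union> I" "e1 \<noteq> e2" "e1 \<noteq> e3" "e2 \<noteq> e3"
    and "cut_vec b W y e1 = 1" "cut_vec b W y e2 = 1" "cut_vec b W y e3 = 1"
  defines "f \<equiv> inc_det b W (insert e1 T) I x"
    and "A \<equiv> inc_det b W (insert e1 (insert e2 T)) I x"
    and "B \<equiv> inc_det b W (insert e1 (insert e3 T)) I x"
    and "C \<equiv> inc_minor b W (insert e1 (insert e2 T)) I e2 e3 x"
    and "R \<equiv> inc_det b W (insert e1 (insert e2 (insert e3 T))) I x"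
  shows "inc_det b W (insert e1 (insert e2 (insert e3 T))) (insert e1 (insert e2 (insert e3 I))) x
    = f * (x e1 * x e2 + x e1 * x e3 + x e2 * x e3) + x e3 * A + x e2 * B + x e1 * (A + B - 2 * C) + R"
    and "f * R = A * B - C\<^sup>2"
proof -
  let ?S = "Inl ` T \<union> Inr ` W" and ?z = "\<lambda>j. case j of Inl _ \<Rightarrow> 0 | Inr w \<Rightarrow> of_int (y w)"
  obtain w where w: "w \<in> W" "(of_int (y w) :: 'k) \<noteq> 0"
    by (rule cut_vec_nonzero[of b W y e1]) (use assms in auto)
  have "inc_det b W T I x = 0"
    using w assms(1-3) by (intro inc_det_null[where y = y]) auto
  moreover have "inc_det b W (insert e2 T) I x = f"
    unfolding f_def using assms(1-12) by (intro inc_det_star_eq) auto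
  moreover have "inc_det b W (insert e3 T) I x = f"
    unfolding f_def using assms(1-12) by (intro inc_det_star_eq) auto
  moreover define D where "D = inc_det b W (insert e2 (insert e3 T)) I x"
  ultimately have "inc_det b W (insert e1 (insert e2 (insert e3 T))) (insert e1 (insert e2 (insert e3 I))) x
    = f * (x e1 * x e2 + x e1 * x e3 + x e2 * x e3) + x e3 * A + x e2 * B + x e1 * D + R"
    using assms(1,2,4-9) inc_det_insert[of "insert e1 (insert e2 T)" W e3 "I" b x]
      inc_det_insert[of "insert e1 (insert e3 T)" W e2 "I" b x]
      inc_det_insert[of "insert e1 (insert e3 T)" W e2 "insert e3 I" b x]
      inc_det_insert[of "insert e1 T" W e2 "I" b x]
      inc_det_insert[of "insert e1 T" W e3 "I" b x]
      inc_det_insert[of "insert e2 T" W e3 "I" b x]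
    by (simp add: inc_det_insert insert_commute[of e3 e2] insert_commute[of e3 e1]
        insert_commute[of e2 e1] f_def[symmetric] A_def[symmetric] B_def[symmetric] R_def[symmetric]
        D_def[symmetric] algebra_simps)
  moreover have "D = A + B - 2 * C"
    unfolding D_def A_def B_def C_def inc_det_def inc_minor_def image_insert Un_insert_left
    by (rule det_on_cut_pair[where z = ?z])
      (use assms(1-12) in \<open>auto simp: inc_mat_cut_vec[OF assms(1,2)] intro: inc_mat_sym split: sum.splits\<close>)
  ultimately show "inc_det b W (insert e1 (insert e2 (insert e3 T))) (insert e1 (insert e2 (insert e3 I))) x
    = f * (x e1 * x e2 + x e1 * x e3 + x e2 * x e3) + x e3 * A + x e2 * B + x e1 * (A + B - 2 * C) + R"
    by simp
  have "R * f = A * B - C\<^sup>2"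
    unfolding R_def A_def B_def C_def f_def inc_det_def inc_minor_def image_insert Un_insert_left
      insert_commute[of "Inl e1 :: 'e + 'a"]
    by (rule det_on_symmetric_jacobi) (use assms(1-9) in \<open>auto simp: inc_mat_cut_vec intro: inc_mat_sym\<close>)
  thus "f * R = A * B - C\<^sup>2" by (simp add: mult.commute)
qed

section \<open>Summing over the variables of a star\<close>

lemma sum_PiE_insert:
  assumes "finite I" "i \<notin> I"
  shows "(\<Sum>x\<in>insert i I \<rightarrow>\<^sub>E UNIV. g x) = (\<Sum>x\<in>I \<rightarrow>\<^sub>E UNIV. \<Sum>t\<in>UNIV. g (x(i := t)))"
proof -
  have "(\<Sum>x\<in>insert i I \<rightarrow>\<^sub>E UNIV. g x) = (\<Sum>(t, x)\<in>UNIV \<times> (I \<rightarrow>\<^sub>E UNIV). g (x(i := t)))"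
    unfolding PiE_insert_eq using inj_combinator[OF assms(2), of "\<lambda>_. UNIV"]
    by (subst sum.reindex) (auto simp: case_prod_unfold)
  also have "\<dots> = (\<Sum>t\<in>UNIV. \<Sum>x\<in>I \<rightarrow>\<^sub>E UNIV. g (x(i := t)))"
    by (rule sum.cartesian_product[symmetric])
  also have "\<dots> = (\<Sum>x\<in>I \<rightarrow>\<^sub>E UNIV. \<Sum>t\<in>UNIV. g (x(i := t)))"
    by (rule sum.swap)
  finally show ?thesis .
qed

lemma card_eq_sum_of_bool:
  assumes "finite X"
  shows "card {x \<in> X. Q x} = (\<Sum>x\<in>X. of_bool (Q x))"
  using assms by (simp add: Int_def)

lemma count_linear:
  fixes L Q :: "'k::{field,finite}"
  shows "(\<Sum>t\<in>UNIV. of_bool (t * L + Q = 0)) = (if L \<noteq> 0 then 1 else if Q = 0 then CARD('k) else 0)"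
proof (cases "L = 0")
  case False
  hence "t * L + Q = 0 \<longleftrightarrow> t = - Q / L" for t by (auto simp: field_simps add_eq_0_iff)
  thus ?thesis using False by simp
qed simp

lemma sum_if_eq:
  fixes h :: "'k::finite" and u v :: nat
  shows "(\<Sum>t\<in>UNIV. if t = h then u else v) = u + (CARD('k) - 1) * v"
  by (simp add: sum.remove[of UNIV h] Compl_eq_Diff_UNIV)

text \<open>The equation is linear in \<open>a1\<close> with coefficient \<open>L\<close>, so only
  pairs with \<open>L = 0\<close> deviate from one solution. For \<open>f\<close> nonzero these are
  \<open>q\<close> pairs, exactly one of which admits all \<open>q\<close> values of
  \<open>a1\<close>: in total \<open>(q - 1) * q + q\<close>. The argument covers characteristic
  2.\<close>

lemma count_star3:
  fixes f A B C R :: "'k::{field,finite}"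
  assumes "f * R = A * B - C\<^sup>2"
  shows "(\<Sum>a3\<in>UNIV. \<Sum>a2\<in>UNIV. \<Sum>a1\<in>UNIV. of_bool (f * (a1 * a2 + a1 * a3 + a2 * a3)
      + a3 * A + a2 * B + a1 * (A + B - 2 * C) + R = 0))
    = (if f = 0 \<and> A = 0 \<and> B = 0 then if R = 0 then CARD('k) ^ 3 else 0 else CARD('k) ^ 2)"
    (is "?S = _")
proof -
  let ?q = "CARD('k)"
  define L where "L = (\<lambda>a3 a2. f * (a2 + a3) + (A + B - 2 * C))"
  define Q where "Q = (\<lambda>a3 a2. f * a2 * a3 + a3 * A + a2 * B + R)"
  have "?S = (\<Sum>a3\<in>UNIV. \<Sum>a2\<in>UNIV. \<Sum>a1\<in>UNIV. of_bool (a1 * L a3 a2 + Q a3 a2 = 0))"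
    by (intro sum.cong refl arg_cong[where f = of_bool]) (simp add: L_def Q_def algebra_simps)
  also have "\<dots> = (\<Sum>a3\<in>UNIV. \<Sum>a2\<in>UNIV. if L a3 a2 \<noteq> 0 then 1 else if Q a3 a2 = 0 then ?q else 0)"
    by (simp add: count_linear)
  also have "\<dots> = (if f = 0 \<and> A = 0 \<and> B = 0 then if R = 0 then ?q ^ 3 else 0 else ?q ^ 2)"
  proof (cases "f = 0")
    case False
    \<comment> \<open>\<open>h a3\<close> is the value of \<open>a2\<close> where the coefficient of
      \<open>a1\<close> vanishes. There \<open>f * Q\<close> is minus the square of
      \<open>f * a3 + B - C\<close>, by the hypothesis on \<open>f * R\<close>, and \<open>c\<close>
      is the only root of that square.\<close>
    define h where "h = (\<lambda>a3. (2 * C - A - B) / f - a3)"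
    define c where "c = (C - B) / f"
    have L0: "L a3 a2 = 0 \<longleftrightarrow> a2 = h a3" for a3 a2
      using False by (auto simp: L_def h_def field_simps)
    have Q0: "Q a3 (h a3) = 0 \<longleftrightarrow> a3 = c" for a3
    proof -
      have fh: "f * h a3 = 2 * C - A - B - f * a3" using False by (simp add: h_def field_simps)
      have "f * Q a3 (h a3) = (f * h a3) * (f * a3) + f * a3 * A + (f * h a3) * B + f * R"
        by (simp add: Q_def algebra_simps)
      also have "\<dots> = - (f * a3 + B - C)\<^sup>2"
        unfolding fh assms by (simp add: power2_eq_square algebra_simps)
      finally have "Q a3 (h a3) = 0 \<longleftrightarrow> f * a3 + B - C = 0" using False by auto
      also have "\<dots> \<longleftrightarrow> a3 = c" using False by (auto simp: c_def field_simps)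
      finally show ?thesis .
    qed
    have "(\<Sum>a3\<in>UNIV. \<Sum>a2\<in>UNIV. if L a3 a2 \<noteq> 0 then 1 else if Q a3 a2 = 0 then ?q else 0)
      = (\<Sum>a3\<in>UNIV. \<Sum>a2\<in>UNIV. if a2 = h a3 then if a3 = c then ?q else 0 else 1)"
      by (intro sum.cong refl) (auto simp: L0 Q0)
    also have "\<dots> = (\<Sum>a3\<in>UNIV. (if a3 = c then ?q else 0) + (?q - 1))"
      by (simp only: sum_if_eq mult_1_right)
    also have "\<dots> = ?q + (?q - 1) * 0 + ?q * (?q - 1)"
      by (simp only: sum.distrib sum_if_eq sum_constant of_nat_id)
    also have "\<dots> = ?q ^ 2"
      by (simp add: power2_eq_square right_diff_distrib' Suc_le_eq)
    finally show ?thesis using False by simp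
  next
    case f: True
    have AB: "A * B = C\<^sup>2" using assms f by simp
    show ?thesis
    proof (cases "A + B - 2 * C = 0")
      case False
      thus ?thesis using f AB by (auto simp: L_def power2_eq_square)
    next
      case True
      hence B: "B = 2 * C - A" by (simp add: algebra_simps)
      \<comment> \<open>Substituting \<open>B = 2 * C - A\<close> into \<open>A * B = C^2\<close>
        leaves a square, so \<open>A\<close>, \<open>B\<close> and \<open>C\<close>
        coincide.\<close>
      have "(A - C)\<^sup>2 = 0" using AB unfolding B by (simp add: power2_eq_square algebra_simps)
      hence CA: "C = A" by simp
      have BA: "B = A" using B CA by simp
      have Q: "Q a3 a2 = a2 * A + (a3 * A + R)" for a3 a2
        by (simp add: Q_def f BA algebra_simps)
      have "(\<Sum>a3\<in>UNIV. \<Sum>a2\<in>UNIV. if L a3 a2 \<noteq> 0 then 1 else if Q a3 a2 = 0 then ?q else 0)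
        = (\<Sum>a3\<in>(UNIV :: 'k set). ?q * (\<Sum>a2\<in>UNIV. of_bool (a2 * A + (a3 * A + R) = 0)))"
        by (simp add: sum_distrib_left L_def f True Q BA CA of_bool_def if_distrib cong: if_cong)
      also have "\<dots> = (if A = 0 then if R = 0 then ?q ^ 3 else 0 else ?q ^ 2)"
        unfolding count_linear by (auto simp: power2_eq_square power3_eq_cube)
      finally show ?thesis using f BA by simp
    qed
  qed
  finally show ?thesis .
qed

section \<open>Counting zeros at a vertex\<close>

abbreviation zeros :: "'i set \<Rightarrow> (('i \<Rightarrow> 'k::zero) \<Rightarrow> 'k) \<Rightarrow> nat" where
  "zeros I F \<equiv> card {x \<in> I \<rightarrow>\<^sub>E UNIV. F x = 0}"

lemma inc_minor_cong:
  assumes "\<And>e. e \<in> I \<Longrightarrow> x e = y e"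
  shows "inc_minor b W T I e e' x = inc_minor b W T I e e' y"
  using inc_mat_cong[of I x y b] assms by (simp add: inc_minor_def)

lemma zeros_star3:
  fixes b :: "'e \<Rightarrow> 'v \<Rightarrow> int"
  assumes "finite T" "finite W" "finite I" "\<And>e. e \<in> T \<Longrightarrow> cut_vec b W y e = 0"
    and "e1 \<notin> T \<union> I" "e2 \<notin> T \<union> I" "e3 \<notin> T \<union> I" "e1 \<noteq> e2" "e1 \<noteq> e3" "e2 \<noteq> e3"
    and "cut_vec b W y e1 = 1" "cut_vec b W y e2 = 1" "cut_vec b W y e3 = 1"
  shows "zeros (insert e1 (insert e2 (insert e3 I)))
      (inc_det b W (insert e1 (insert e2 (insert e3 T))) (insert e1 (insert e2 (insert e3 I)))
        :: ('e \<Rightarrow> 'k::{field,finite}) \<Rightarrow> 'k)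
    = (\<Sum>x\<in>I \<rightarrow>\<^sub>E (UNIV :: 'k set). if inc_det b W (insert e1 T) I x = 0
          \<and> inc_det b W (insert e1 (insert e2 T)) I x = 0 \<and> inc_det b W (insert e1 (insert e3 T)) I x = 0
        then if inc_det b W (insert e1 (insert e2 (insert e3 T))) I x = 0 then CARD('k) ^ 3 else 0
        else CARD('k) ^ 2)"
    (is "zeros ?I ?F = _")
proof -
  have "zeros ?I ?F = (\<Sum>x\<in>?I \<rightarrow>\<^sub>E UNIV. of_bool (?F x = 0))"
    using assms(3) by (intro card_eq_sum_of_bool finite_PiE) auto
  also have "\<dots> = (\<Sum>x\<in>I \<rightarrow>\<^sub>E UNIV. \<Sum>a3\<in>UNIV. \<Sum>a2\<in>UNIV. \<Sum>a1\<in>UNIV.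
      of_bool (?F (x(e3 := a3, e2 := a2, e1 := a1)) = 0))"
    using assms(3,5-10) by (simp add: sum_PiE_insert)
  also have "\<dots> = (\<Sum>x\<in>I \<rightarrow>\<^sub>E (UNIV :: 'k set). if inc_det b W (insert e1 T) I x = 0
          \<and> inc_det b W (insert e1 (insert e2 T)) I x = 0 \<and> inc_det b W (insert e1 (insert e3 T)) I x = 0
        then if inc_det b W (insert e1 (insert e2 (insert e3 T))) I x = 0 then CARD('k) ^ 3 else 0
        else CARD('k) ^ 2)"
  proof (intro sum.cong refl, goal_cases)
    case (1 x)
    note star = inc_det_star3[of T W b y e1 I e2 e3, OF assms(1,2,4-)]
    have c: "inc_det b W S I (x(e3 := a3, e2 := a2, e1 := a1)) = inc_det b W S I x"
      "inc_minor b W S I e2 e3 (x(e3 := a3, e2 := a2, e1 := a1)) = inc_minor b W S I e2 e3 x" for S a1 a2 a3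
      using assms(5-7) by (auto intro!: inc_det_cong inc_minor_cong)
    have "?F (x(e3 := a3, e2 := a2, e1 := a1))
      = inc_det b W (insert e1 T) I x * (a1 * a2 + a1 * a3 + a2 * a3)
        + a3 * inc_det b W (insert e1 (insert e2 T)) I x + a2 * inc_det b W (insert e1 (insert e3 T)) I x
        + a1 * (inc_det b W (insert e1 (insert e2 T)) I x + inc_det b W (insert e1 (insert e3 T)) I x
          - 2 * inc_minor b W (insert e1 (insert e2 T)) I e2 e3 x)
        + inc_det b W (insert e1 (insert e2 (insert e3 T))) I x" for a1 a2 a3
      using assms(8-10) by (subst star(1)) (simp_all add: c)
    thus ?case by (simp only: count_star3[OF star(2)])
  qed
  finally show ?thesis .
qed

lemma zeros_star2:
  fixes b :: "'e \<Rightarrow> 'v \<Rightarrow> int"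
  assumes "finite T" "finite W" "finite I" "\<And>e. e \<in> T \<Longrightarrow> cut_vec b W y e = 0"
    and "e1 \<notin> T \<union> I" "e2 \<notin> T \<union> I" "e1 \<noteq> e2"
    and "cut_vec b W y e1 = 1" "cut_vec b W y e2 = 1"
  shows "zeros (insert e1 (insert e2 I))
      (inc_det b W (insert e1 (insert e2 T)) (insert e1 (insert e2 I))
        :: ('e \<Rightarrow> 'k::{field,finite}) \<Rightarrow> 'k)
    = (\<Sum>x\<in>I \<rightarrow>\<^sub>E (UNIV :: 'k set). CARD('k) * (if inc_det b W (insert e1 T) I x \<noteq> 0 then 1
        else if inc_det b W (insert e1 (insert e2 T)) I x = 0 then CARD('k) else 0))"
    (is "zeros ?I ?F = _")
proof -
  have "zeros ?I ?F = (\<Sum>x\<in>?I \<rightarrow>\<^sub>E UNIV. of_bool (?F x = 0))"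
    using assms(3) by (intro card_eq_sum_of_bool finite_PiE) auto
  also have "\<dots> = (\<Sum>x\<in>I \<rightarrow>\<^sub>E UNIV. \<Sum>a2\<in>UNIV. \<Sum>a1\<in>UNIV. of_bool (?F (x(e2 := a2, e1 := a1)) = 0))"
    using assms(3,5-7) by (simp add: sum_PiE_insert)
  also have "\<dots> = (\<Sum>x\<in>I \<rightarrow>\<^sub>E (UNIV :: 'k set). CARD('k) * (if inc_det b W (insert e1 T) I x \<noteq> 0 then 1
        else if inc_det b W (insert e1 (insert e2 T)) I x = 0 then CARD('k) else 0))"
  proof (intro sum.cong refl, goal_cases)
    case (1 x)
    let ?f = "inc_det b W (insert e1 T) I x" and ?R = "inc_det b W (insert e1 (insert e2 T)) I x"
    have c: "inc_det b W S I (x(e2 := a2, e1 := a1)) = inc_det b W S I x" for S a1 a2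
      using assms(5,6) by (auto intro!: inc_det_cong)
    have "?F (x(e2 := a2, e1 := a1)) = a1 * ?f + (a2 * ?f + ?R)" for a1 a2
      using assms(7) by (subst inc_det_star2[OF assms(1,2,4-)]) (auto simp: c algebra_simps)
    hence "(\<Sum>a2\<in>UNIV. \<Sum>a1\<in>UNIV. of_bool (?F (x(e2 := a2, e1 := a1)) = 0))
      = (\<Sum>a2\<in>(UNIV :: 'k set). if ?f \<noteq> 0 then 1 else if a2 * ?f + ?R = 0 then CARD('k) else 0)"
      by (simp only: count_linear)
    thus ?case by auto
  qed
  finally show ?thesis .
qed

text \<open>The equation is linear in the variable of \<open>e\<close>. Thus a count with one more
  variable gives access to the common zeros of its two coefficients, multiplied by
  \<open>q\<close>.\<close>

lemma zeros_edge:
  fixes b :: "'e \<Rightarrow> 'v \<Rightarrow> int"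
  assumes "finite T" "finite W" "finite I" "e \<notin> T \<union> I"
  shows "zeros (insert e I) (inc_det b W (insert e T) (insert e I) :: ('e \<Rightarrow> 'k::{field,finite}) \<Rightarrow> 'k)
      + zeros I (inc_det b W T I :: ('e \<Rightarrow> 'k) \<Rightarrow> 'k)
    = CARD('k) ^ card I + CARD('k) *
      card {x \<in> I \<rightarrow>\<^sub>E (UNIV :: 'k set). inc_det b W T I x = 0 \<and> inc_det b W (insert e T) I x = 0}"
    (is "zeros ?I ?F + _ = _")
proof -
  have fin: "finite (I \<rightarrow>\<^sub>E (UNIV :: 'k set))" using assms(3) by (intro finite_PiE) auto
  have "zeros ?I ?F = (\<Sum>x\<in>?I \<rightarrow>\<^sub>E UNIV. of_bool (?F x = 0))"
    using assms(3) by (intro card_eq_sum_of_bool finite_PiE) auto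
  also have "\<dots> = (\<Sum>x\<in>I \<rightarrow>\<^sub>E UNIV. \<Sum>a\<in>UNIV. of_bool (?F (x(e := a)) = 0))"
    using assms(3,4) by (simp add: sum_PiE_insert)
  also have "\<dots> = (\<Sum>x\<in>I \<rightarrow>\<^sub>E (UNIV :: 'k set). if inc_det b W T I x \<noteq> 0 then 1
        else if inc_det b W (insert e T) I x = 0 then CARD('k) else 0)"
  proof (intro sum.cong refl, goal_cases)
    case (1 x)
    have c: "inc_det b W S I (x(e := a)) = inc_det b W S I x" for S a
      using assms(4) by (auto intro!: inc_det_cong)
    have "?F (x(e := a)) = a * inc_det b W T I x + inc_det b W (insert e T) I x" for a
      using assms by (subst inc_det_insert) (auto simp: c)
    thus ?case by (simp only: count_linear)
  qed
  finally have "zeros ?I ?F + zeros I (inc_det b W T I :: ('e \<Rightarrow> 'k) \<Rightarrow> 'k)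
    = (\<Sum>x\<in>I \<rightarrow>\<^sub>E (UNIV :: 'k set). (if inc_det b W T I x \<noteq> 0 then 1
        else if inc_det b W (insert e T) I x = 0 then CARD('k) else 0) + of_bool (inc_det b W T I x = 0))"
    unfolding card_eq_sum_of_bool[OF fin] by (simp only: sum.distrib)
  also have "\<dots> = (\<Sum>x\<in>I \<rightarrow>\<^sub>E (UNIV :: 'k set). 1 + CARD('k) *
      of_bool (inc_det b W T I x = 0 \<and> inc_det b W (insert e T) I x = 0))"
    by (intro sum.cong) auto
  also have "\<dots> = CARD('k) ^ card I + CARD('k) *
      card {x \<in> I \<rightarrow>\<^sub>E (UNIV :: 'k set). inc_det b W T I x = 0 \<and> inc_det b W (insert e T) I x = 0}"
    unfolding card_eq_sum_of_bool[OF fin] sum.distrib sum_distrib_left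
    using assms(3) by (simp add: card_PiE)
  finally show ?thesis .
qed

lemma dvd_zeros_of_degree:
  fixes F :: "'i int_mpoly"
  assumes "finite I" "deg_le I d F" "d < card I" "prime p" "CARD('k::{field,finite}) = p ^ s"
  shows "p dvd zeros I (\<lambda>x :: 'i \<Rightarrow> 'k. eval_mpoly x F)"
proof -
  have "of_nat (zeros I (\<lambda>x :: 'i \<Rightarrow> 'k. eval_mpoly x F)) = (0 :: 'k)"
    by (rule chevalley_warning[OF assms(1-3)])
  thus ?thesis using CHAR_eq_of_CARD[OF assms(5,4)] by (simp add: of_nat_eq_0_iff_char_dvd)
qed

lemma dvd_zeros_inc_det:
  fixes b :: "'e \<Rightarrow> 'v \<Rightarrow> int"
  assumes "finite T" "finite W" "finite I" "card T - card W < card I"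
    "prime p" "CARD('k::{field,finite}) = p ^ s"
  shows "p dvd zeros I (inc_det b W T I :: ('e \<Rightarrow> 'k) \<Rightarrow> 'k)"
  using dvd_zeros_of_degree[OF assms(3) deg_le_inc_det[OF assms(1-3)] assms(4-6)]
  by (simp add: eval_inc_det)

text \<open>For three edges at \<open>u\<close> the star count gives the factor \<open>q^2\<close>.
  For two edges it gives \<open>q\<close> times a sum congruent modulo \<open>p\<close> to the
  number of points where the leading coefficient is nonzero. That number is divisible by
  \<open>p\<close> by Chevalley-Warning: the coefficient has degree at most
  \<open>card T - 1 - card W\<close> in \<open>card I - 2\<close> variables. Two edges occur when
  \<open>u\<close> is adjacent to the root and that edge is deleted.\<close>

lemma dvd_zeros_of_vertex:
  fixes b :: "'e \<Rightarrow> 'v \<Rightarrow> int"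
  assumes fin: "finite T" "finite W" and "I \<subseteq> T" "u \<in> W"
    and G: "{e \<in> T. b e u \<noteq> 0} \<subseteq> I" "\<And>e. e \<in> T \<Longrightarrow> b e u \<noteq> 0 \<Longrightarrow> b e u = 1"
    and deg: "card {e \<in> T. b e u \<noteq> 0} = 3 \<or>
      card {e \<in> T. b e u \<noteq> 0} = 2 \<and> card T - 1 - card W < card I - 2"
    and q: "prime p" "CARD('k::{field,finite}) = p ^ s" "s \<ge> 1"
  shows "p * CARD('k) dvd zeros I (inc_det b W T I :: ('e \<Rightarrow> 'k) \<Rightarrow> 'k)"
proof -
  let ?G = "{e \<in> T. b e u \<noteq> 0}" and ?q = "CARD('k)"
  define T' where "T' = T - ?G"
  define I' where "I' = I - ?G"
  have finI: "finite I" using assms finite_subset by blast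
  have fin': "finite T'" "finite I'" using fin finI by (auto simp: T'_def I'_def)
  have pq: "p dvd ?q" using q by (simp add: dvd_power)
  have cut: "cut_vec b W (\<lambda>w. if w = u then 1 else 0) e = b e u" for e
    using fin \<open>u \<in> W\<close> by (simp add: cut_vec_def if_distrib cong: if_cong)
  have T'0: "b e u = 0" if "e \<in> T'" for e using that by (auto simp: T'_def)
  from deg show ?thesis
  proof
    assume "card ?G = 3"
    then obtain g1 g2 g3 where g: "?G = {g1, g2, g3}" "g1 \<noteq> g2" "g1 \<noteq> g3" "g2 \<noteq> g3"
      by (auto simp: card_3_iff)
    have gT: "T = insert g1 (insert g2 (insert g3 T'))" "I = insert g1 (insert g2 (insert g3 I'))"
      using g(1) G(1) by (auto simp: T'_def I'_def)
    have b1: "b g1 u = 1" "b g2 u = 1" "b g3 u = 1" using g(1) G(2) by auto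
    have notin: "g1 \<notin> T' \<union> I'" "g2 \<notin> T' \<union> I'" "g3 \<notin> T' \<union> I'"
      using g(1) by (auto simp: T'_def I'_def)
    have "?q ^ 2 dvd zeros I (inc_det b W T I :: ('e \<Rightarrow> 'k) \<Rightarrow> 'k)"
      unfolding gT
      by (subst zeros_star3[where y = "\<lambda>w. if w = u then 1 else 0"])
        (use fin fin' g notin T'0 b1 in \<open>auto simp: cut intro!: dvd_sum le_imp_power_dvd\<close>)
    moreover have "p * ?q dvd ?q ^ 2" using pq by (simp add: power2_eq_square)
    ultimately show ?thesis by (rule dvd_trans[rotated])
  next
    assume d: "card ?G = 2 \<and> card T - 1 - card W < card I - 2"
    then obtain g1 g2 where g: "?G = {g1, g2}" "g1 \<noteq> g2"
      by (auto simp: card_2_iff)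
    have gT: "T = insert g1 (insert g2 T')" "I = insert g1 (insert g2 I')"
      using g(1) G(1) by (auto simp: T'_def I'_def)
    have b1: "b g1 u = 1" "b g2 u = 1" using g(1) G(2) by auto
    have notin: "g1 \<notin> T' \<union> I'" "g2 \<notin> T' \<union> I'"
      using g(1) by (auto simp: T'_def I'_def)
    let ?f = "inc_det b W (insert g1 T') I' :: ('e \<Rightarrow> 'k) \<Rightarrow> 'k"
    let ?R = "inc_det b W (insert g1 (insert g2 T')) I' :: ('e \<Rightarrow> 'k) \<Rightarrow> 'k"
    let ?X = "I' \<rightarrow>\<^sub>E (UNIV :: 'k set)"
    have finX: "finite ?X" using fin' by (intro finite_PiE) auto
    have "card I = card I' + 2" "card T = card T' + 2"
      unfolding gT using notin g(2) fin' by auto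
    \<comment> \<open>The degree bound of \<open>?f\<close> against the number of variables left
      after removing the two at \<open>u\<close>.\<close>
    hence "card (insert g1 T') - card W < card I'"
      using d notin fin' by auto
    hence pf: "p dvd zeros I' ?f"
      using fin fin' q by (intro dvd_zeros_inc_det) auto
    have XE: "zeros I' ?f + card {x \<in> ?X. ?f x \<noteq> 0} = card ?X"
      using finX by (subst card_Un_disjoint[symmetric]) (auto intro!: arg_cong[where f = card])
    have "p dvd card ?X"
    proof -
      have "card I' \<noteq> 0" using \<open>card (insert g1 T') - card W < card I'\<close> by simp
      hence "?q dvd ?q ^ card I'" by (intro dvd_power) auto
      with pq have "p dvd ?q ^ card I'" by (rule dvd_trans)
      thus ?thesis using fin' by (simp add: card_PiE)
    qed
    hence pnf: "p dvd card {x \<in> ?X. ?f x \<noteq> 0}"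
      unfolding XE[symmetric] dvd_add_right_iff[OF pf] .
    have "(\<Sum>x\<in>?X. if ?f x \<noteq> 0 then 1 else if ?R x = 0 then ?q else 0)
      = card {x \<in> ?X. ?f x \<noteq> 0} + ?q * card {x \<in> ?X. ?f x = 0 \<and> ?R x = 0}"
      unfolding card_eq_sum_of_bool[OF finX] sum_distrib_left sum.distrib[symmetric]
      by (intro sum.cong) auto
    hence "p dvd (\<Sum>x\<in>?X. if ?f x \<noteq> 0 then 1 else if ?R x = 0 then ?q else 0)"
      using pnf pq by simp
    moreover have "zeros I (inc_det b W T I :: ('e \<Rightarrow> 'k) \<Rightarrow> 'k)
      = ?q * (\<Sum>x\<in>?X. if ?f x \<noteq> 0 then 1 else if ?R x = 0 then ?q else 0)"
      unfolding gT
      by (subst zeros_star2[where y = "\<lambda>w. if w = u then 1 else 0"])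
        (use fin fin' g notin T'0 b1 in \<open>auto simp: cut sum_distrib_left\<close>)
    ultimately show ?thesis by (simp add: mult.commute)
  qed
qed

lemma zeros_div_square_cong:
  fixes b :: "'e \<Rightarrow> 'v \<Rightarrow> int"
  assumes fin: "finite T" "finite W"
    and T: "\<And>e. e \<in> T \<Longrightarrow> cut_vec b W (\<lambda>_. 1) e = 0"
    and e: "e1 \<notin> T" "e2 \<notin> T" "e3 \<notin> T" "e1 \<noteq> e2" "e1 \<noteq> e3" "e2 \<noteq> e3"
    and c: "cut_vec b W (\<lambda>_. 1) e1 = 1" "cut_vec b W (\<lambda>_. 1) e2 = 1" "cut_vec b W (\<lambda>_. 1) e3 = 1"
    and u: "u \<in> W" "card {e \<in> insert e1 T. b e u \<noteq> 0} = 3"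
      "\<And>e. e \<in> insert e1 T \<Longrightarrow> b e u \<noteq> 0 \<Longrightarrow> b e u = 1" "b e2 u = 0" "b e3 u = 0"
    and W: "card W \<ge> 3" and cT: "card T + 3 = 2 * card W"
    and q: "prime p" "CARD('k::{field,finite}) = p ^ s" "s \<ge> 1"
  defines "E \<equiv> insert e1 (insert e2 (insert e3 T))"
    and "F \<equiv> inc_det b W (insert e1 T) T var * inc_minor b W (insert e1 (insert e2 T)) T e2 e3 var"
  shows "[int (zeros E (inc_det b W E E :: ('e \<Rightarrow> 'k) \<Rightarrow> 'k)) div int (CARD('k) ^ 2)
    = - int (zeros T (\<lambda>x :: 'e \<Rightarrow> 'k. eval_mpoly x F))] (mod int p)"
proof -
  let ?q = "CARD('k)" and ?X = "T \<rightarrow>\<^sub>E (UNIV :: 'k set)"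
  define f where "f = (inc_det b W (insert e1 T) T :: ('e \<Rightarrow> 'k) \<Rightarrow> 'k)"
  define A where "A = (inc_det b W (insert e1 (insert e2 T)) T :: ('e \<Rightarrow> 'k) \<Rightarrow> 'k)"
  define B where "B = (inc_det b W (insert e1 (insert e3 T)) T :: ('e \<Rightarrow> 'k) \<Rightarrow> 'k)"
  define C where "C = (inc_minor b W (insert e1 (insert e2 T)) T e2 e3 :: ('e \<Rightarrow> 'k) \<Rightarrow> 'k)"
  define R where "R = (inc_det b W E T :: ('e \<Rightarrow> 'k) \<Rightarrow> 'k)"
  have finX: "finite ?X" using fin by (intro finite_PiE) auto
  have q0: "?q > 0" by simp
  have p0: "p > 0" using q(1) prime_gt_0_nat by blast
  have pq: "p dvd ?q" using q by (simp add: dvd_power)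
  have fR: "f x * R x = A x * B x - (C x)\<^sup>2" for x
    unfolding f_def R_def A_def B_def C_def E_def
    by (rule inc_det_star3(2)[where y = "\<lambda>_. 1"]) (use fin T e c in auto)
  \<comment> \<open>The contracted edge \<open>e1\<close> may end at \<open>u\<close>, whereas
    \<open>e2\<close> and \<open>e3\<close> do not. Rewriting \<open>f\<close> with one of these
    ensures that all edges at \<open>u\<close> carry variables, as
    \<open>dvd_zeros_of_vertex\<close> requires.\<close>
  have f2: "inc_det b W (insert e2 T) T = f" and f3: "inc_det b W (insert e3 T) T = f"
    unfolding f_def using fin T e c by (auto intro!: ext inc_det_star_eq[where y = "\<lambda>_. 1"])
  let ?Z = "card {x \<in> ?X. f x = 0 \<and> A x = 0 \<and> B x = 0}"
  let ?Z' = "card {x \<in> ?X. (f x = 0 \<and> A x = 0 \<and> B x = 0) \<and> R x = 0}"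
  let ?A1 = "card {x \<in> ?X. f x = 0 \<and> C x = 0}"
  let ?A12 = "card {x \<in> ?X. f x = 0 \<and> A x = 0}"
  let ?A13 = "card {x \<in> ?X. f x = 0 \<and> B x = 0}"
  let ?N = "zeros E (inc_det b W E E :: ('e \<Rightarrow> 'k) \<Rightarrow> 'k)"

  \<comment> \<open>Where \<open>f = A = B = 0\<close> the fibre has \<open>q^3\<close> or 0 points
    instead of \<open>q^2\<close>. So the quotient by \<open>q^2\<close> is
    \<open>q ^ card T + q * ?Z' - ?Z\<close>, written here without subtraction, and \<open>R\<close>
    matters only modulo \<open>q\<close>.\<close>
  have N: "?N + ?q\<^sup>2 * ?Z = ?q\<^sup>2 * (?q ^ card T + ?q * ?Z')"
  proof -
    have "?N = (\<Sum>x\<in>?X. if f x = 0 \<and> A x = 0 \<and> B x = 0 then if R x = 0 then ?q ^ 3 else 0 else ?q ^ 2)"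
      unfolding E_def f_def A_def B_def R_def
      by (rule zeros_star3[where y = "\<lambda>_. 1"]) (use fin T e c in auto)
    hence "?N + ?q\<^sup>2 * ?Z = (\<Sum>x\<in>?X. (if f x = 0 \<and> A x = 0 \<and> B x = 0 then if R x = 0 then ?q ^ 3 else 0 else ?q ^ 2)
        + ?q\<^sup>2 * of_bool (f x = 0 \<and> A x = 0 \<and> B x = 0))"
      by (simp only: card_eq_sum_of_bool[OF finX] sum.distrib sum_distrib_left)
    also have "\<dots> = (\<Sum>x\<in>?X. ?q\<^sup>2 * (1 + ?q * of_bool ((f x = 0 \<and> A x = 0 \<and> B x = 0) \<and> R x = 0)))"
      by (intro sum.cong) (auto simp: power2_eq_square power3_eq_cube)
    also have "\<dots> = ?q\<^sup>2 * ((\<Sum>x\<in>?X. 1) + ?q * ?Z')"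
      by (simp only: card_eq_sum_of_bool[OF finX] sum_distrib_left[symmetric] sum.distrib)
    also have "(\<Sum>x\<in>?X. 1) = card ?X" by simp
    also have "card ?X = ?q ^ card T" using fin by (simp add: card_PiE)
    finally show ?thesis .
  qed
  have cardT: "card T \<ge> 3" using W cT by simp
  have Nf: "p * ?q dvd zeros T f"
  proof -
    have G: "{e \<in> insert e2 T. b e u \<noteq> 0} = {e \<in> T. b e u \<noteq> 0}" using u by auto
    have "card {e \<in> T. b e u \<noteq> 0} = 3 \<or> card {e \<in> T. b e u \<noteq> 0} = 2"
    proof (cases "b e1 u = 0")
      case True
      hence "{e \<in> insert e1 T. b e u \<noteq> 0} = {e \<in> T. b e u \<noteq> 0}" by auto
      thus ?thesis using u(2) by simp
    next
      case False
      hence "{e \<in> insert e1 T. b e u \<noteq> 0} = insert e1 {e \<in> T. b e u \<noteq> 0}" by auto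
      thus ?thesis using u(2) fin e by simp
    qed
    moreover have "card (insert e2 T) - 1 - card W < card T - 2"
      using W cT fin e by simp
    ultimately have "card {e \<in> insert e2 T. b e u \<noteq> 0} = 3 \<or>
      card {e \<in> insert e2 T. b e u \<noteq> 0} = 2 \<and> card (insert e2 T) - 1 - card W < card T - 2"
      unfolding G by blast
    thus ?thesis
      unfolding f2[symmetric] using fin u(1) q
      by (intro dvd_zeros_of_vertex[where u = u and s = s]) (use u in auto)
  qed
  \<comment> \<open>Giving \<open>e1\<close> its variable back produces the polynomial
    \<open>x e1 * f + A\<close> (or \<open>B\<close> for \<open>A\<close>), with all three edges at
    \<open>u\<close> available. In \<open>zeros_edge\<close> everything but \<open>q\<close> times
    the wanted number is then divisible by \<open>p * q\<close>.\<close>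
  have pairs: "p dvd card {x \<in> ?X. f x = 0 \<and> inc_det b W (insert e1 (insert e' T)) T x = 0}"
    if e': "e' \<notin> T" "e' \<noteq> e1" "b e' u = 0" and fe': "inc_det b W (insert e' T) T = f" for e'
  proof -
    have G: "{e \<in> insert e1 (insert e' T). b e u \<noteq> 0} = {e \<in> insert e1 T. b e u \<noteq> 0}" using e' by auto
    have H: "p * ?q dvd zeros (insert e1 T) (inc_det b W (insert e1 (insert e' T)) (insert e1 T) :: ('e \<Rightarrow> 'k) \<Rightarrow> 'k)"
    proof (rule dvd_zeros_of_vertex[where u = u and s = s])
      show "card {e \<in> insert e1 (insert e' T). b e u \<noteq> 0} = 3 \<or>
        card {e \<in> insert e1 (insert e' T). b e u \<noteq> 0} = 2 \<and>
        card (insert e1 (insert e' T)) - 1 - card W < card (insert e1 T) - 2"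
        unfolding G using u(2) by simp
    qed (use fin u q e' in auto)
    have eq: "zeros (insert e1 T) (inc_det b W (insert e1 (insert e' T)) (insert e1 T) :: ('e \<Rightarrow> 'k) \<Rightarrow> 'k)
       + zeros T f = ?q ^ card T + ?q * card {x \<in> ?X. f x = 0 \<and> inc_det b W (insert e1 (insert e' T)) T x = 0}"
      using zeros_edge[of "insert e' T" W T e1 b, where ?'k = 'k] fin e e' by (simp add: fe')
    have qT: "p * ?q dvd ?q ^ card T"
    proof -
      have "p * ?q dvd ?q ^ 2" using pq by (simp add: power2_eq_square)
      also have "\<dots> dvd ?q ^ card T" using cardT by (intro le_imp_power_dvd) simp
      finally show ?thesis .
    qed
    have "p * ?q dvd ?q ^ card T + ?q * card {x \<in> ?X. f x = 0 \<and> inc_det b W (insert e1 (insert e' T)) T x = 0}"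
      unfolding eq[symmetric] using H Nf by (rule dvd_add)
    hence "p * ?q dvd ?q * card {x \<in> ?X. f x = 0 \<and> inc_det b W (insert e1 (insert e' T)) T x = 0}"
      unfolding dvd_add_right_iff[OF qT] .
    thus ?thesis by (simp add: mult.commute)
  qed
  have A12: "p dvd ?A12" unfolding A_def using pairs[of e2] e u f2 by auto
  have A13: "p dvd ?A13" unfolding B_def using pairs[of e3] e u f3 by auto
  have A1: "?A1 + ?Z = ?A12 + ?A13"
  proof -
    have "{x \<in> ?X. f x = 0 \<and> C x = 0} = {x \<in> ?X. f x = 0 \<and> A x = 0} \<union> {x \<in> ?X. f x = 0 \<and> B x = 0}"
    proof -
      have "C x = 0 \<longleftrightarrow> A x = 0 \<or> B x = 0" if "f x = 0" for x
        using fR[of x] that by (auto simp: power2_eq_square)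
      thus ?thesis by auto
    qed
    moreover have "{x \<in> ?X. f x = 0 \<and> A x = 0 \<and> B x = 0} = {x \<in> ?X. f x = 0 \<and> A x = 0} \<inter> {x \<in> ?X. f x = 0 \<and> B x = 0}"
      by auto
    ultimately show ?thesis
      using card_Un_Int[of "{x \<in> ?X. f x = 0 \<and> A x = 0}" "{x \<in> ?X. f x = 0 \<and> B x = 0}"] finX by simp
  qed
  have NC: "p dvd zeros T C"
  proof -
    have "card (insert e1 (insert e2 T)) - card W < card T" using fin e W cardT by simp
    from dvd_zeros_of_degree[OF fin(1) deg_le_inc_minor this q(1,2), of e3 b e2]
    show ?thesis using fin e by (simp add: eval_inc_minor C_def)
  qed
  have fC: "zeros T (\<lambda>x. f x * C x) + ?A1 = zeros T f + zeros T C"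
  proof -
    have "{x \<in> ?X. f x * C x = 0} = {x \<in> ?X. f x = 0} \<union> {x \<in> ?X. C x = 0}" by auto
    moreover have "{x \<in> ?X. f x = 0 \<and> C x = 0} = {x \<in> ?X. f x = 0} \<inter> {x \<in> ?X. C x = 0}" by auto
    ultimately show ?thesis
      using card_Un_Int[of "{x \<in> ?X. f x = 0}" "{x \<in> ?X. C x = 0}"] finX by simp
  qed
  have F: "eval_mpoly x F = f x * C x" for x
    by (simp add: F_def f_def C_def eval_mpoly_mult eval_inc_det eval_inc_minor)
  have "int ?N = int (?q\<^sup>2) * (int (?q ^ card T + ?q * ?Z') - int ?Z)"
    using arg_cong[OF N, of int] by (simp add: algebra_simps)
  hence Nq: "int ?N div int (?q\<^sup>2) = int (?q ^ card T + ?q * ?Z') - int ?Z"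
    using q0 by simp
  have d1: "int p dvd int (?q ^ card T + ?q * ?Z')"
  proof -
    have "?q dvd ?q ^ card T" using cardT by (intro dvd_power) auto
    with pq have "p dvd ?q ^ card T" by (rule dvd_trans)
    thus ?thesis using pq by (simp only: int_dvd_int_iff) simp
  qed
  have d2: "int p dvd int (zeros T (\<lambda>x. f x * C x)) - int ?Z"
  proof -
    have "int (zeros T (\<lambda>x. f x * C x)) - int ?Z = int (zeros T f) + int (zeros T C) - (int ?A12 + int ?A13)"
      using arg_cong[OF fC, of int] arg_cong[OF A1, of int] by simp
    moreover have "p dvd zeros T f" using Nf by (rule dvd_mult_left)
    ultimately show ?thesis using NC A12 A13
      by (simp only:) (intro dvd_add dvd_diff, auto)
  qed
  have "int ?N div int (?q\<^sup>2) - - int (zeros T (\<lambda>x. f x * C x))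
    = int (?q ^ card T + ?q * ?Z') + (int (zeros T (\<lambda>x. f x * C x)) - int ?Z)"
    unfolding Nq by simp
  hence "int p dvd int ?N div int (?q\<^sup>2) - - int (zeros T (\<lambda>x. f x * C x))"
    using dvd_add[OF d1 d2] by (simp only:)
  thus ?thesis unfolding F by (simp only: cong_iff_dvd_diff)
qed

section \<open>The matrix-tree theorem\<close>

text \<open>Trees built by attaching leaves, so that proofs can peel off the last leaf; this is the
  form needed for expanding the determinant.\<close>

inductive grown_tree :: "'v \<Rightarrow> 'v set \<Rightarrow> 'v set set \<Rightarrow> bool" for r where
  root: "grown_tree r {} {}"
| leaf: "grown_tree r W T \<Longrightarrow> w \<notin> insert r W \<Longrightarrow> y \<in> insert r W \<Longrightarrow>
    grown_tree r (insert w W) (insert {w, y} T)"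

lemma grown_tree_edge_subset: "grown_tree r W T \<Longrightarrow> e \<in> T \<Longrightarrow> e \<subseteq> insert r W"
  by (induction rule: grown_tree.induct) auto

lemma grown_tree_finite: "grown_tree r W T \<Longrightarrow> finite W \<and> finite T \<and> r \<notin> W"
  by (induction rule: grown_tree.induct) auto

lemma grown_tree_card: "grown_tree r W T \<Longrightarrow> card T = card W"
proof (induction rule: grown_tree.induct)
  case (leaf W T w y)
  have "{w, y} \<notin> T" using grown_tree_edge_subset[OF leaf.hyps(1)] leaf.hyps(2) by auto
  thus ?case using leaf grown_tree_finite[OF leaf.hyps(1)] by simp
qed simp

lemma adj_sym: "(u, w) \<in> (adj G)\<^sup>* \<Longrightarrow> (w, u) \<in> (adj G)\<^sup>*"
proof -
  have "sym (adj G)" by (auto simp: sym_def adj_def insert_commute)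
  thus "(u, w) \<in> (adj G)\<^sup>* \<Longrightarrow> (w, u) \<in> (adj G)\<^sup>*"
    using sym_rtrancl by (metis symD)
qed

lemma grown_tree_reaches_root:
  "grown_tree r W T \<Longrightarrow> u \<in> insert r W \<Longrightarrow> (r, u) \<in> (adj (V, T))\<^sup>*"
proof (induction arbitrary: u rule: grown_tree.induct)
  case (leaf W T w y)
  have "adj (V, T) \<subseteq> adj (V, insert {w, y} T)" by (auto simp: adj_def)
  hence mono: "(adj (V, T))\<^sup>* \<subseteq> (adj (V, insert {w, y} T))\<^sup>*" by (rule rtrancl_mono)
  show ?case
  proof (cases "u = w")
    case True
    have "(r, y) \<in> (adj (V, insert {w, y} T))\<^sup>*" using leaf.IH[OF leaf.hyps(3)] mono by blast
    moreover have "(y, w) \<in> adj (V, insert {w, y} T)" by (auto simp: adj_def insert_commute)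
    ultimately show ?thesis using True by (meson rtrancl.rtrancl_into_rtrancl)
  next
    case False
    thus ?thesis using leaf mono by blast
  qed
qed simp

lemma grown_tree_connected:
  assumes "grown_tree r (V - {r}) T" "r \<in> V"
  shows "connected_graph (V, T)"
  unfolding connected_graph_def
proof (intro conjI ballI)
  fix u w assume "u \<in> verts (V, T)" "w \<in> verts (V, T)"
  hence "(r, u) \<in> (adj (V, T))\<^sup>*" "(r, w) \<in> (adj (V, T))\<^sup>*"
    by (auto intro!: grown_tree_reaches_root[OF assms(1)])
  thus "(u, w) \<in> (adj (V, T))\<^sup>*" using adj_sym rtrancl_trans by metis
qed (use assms in auto)

text \<open>The new leaf \<open>w\<close> has only the edge to \<open>y\<close>. On a cycle both its
  neighbours would be \<open>y\<close>, contradicting distinctness; a cycle avoiding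
  \<open>w\<close> lies in the smaller tree.\<close>

lemma grown_tree_no_cycle:
  "grown_tree r W T \<Longrightarrow> \<not> is_cycle (V, T) vs"
proof (induction rule: grown_tree.induct)
  case root
  show ?case by (cases vs) (auto simp: is_cycle_def)
next
  case (leaf W T w y)
  show ?case
  proof
    assume cyc: "is_cycle (V, insert {w, y} T) vs"
    let ?n = "length vs"
    have n: "?n \<ge> 3" and dist: "distinct vs"
      and ed: "\<And>i. i < ?n \<Longrightarrow> {vs ! i, vs ! (Suc i mod ?n)} \<in> insert {w, y} T"
      using cyc by (auto simp: is_cycle_def)
    have wT: "w \<notin> e" if "e \<in> T" for e
      using grown_tree_edge_subset[OF leaf.hyps(1) that] leaf.hyps(2) by auto
    show False
    proof (cases "w \<in> set vs")
      case True
      then obtain i where i: "i < ?n" "vs ! i = w" by (auto simp: in_set_conv_nth)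
      define j where "j = (if i = 0 then ?n - 1 else i - 1)"
      define k where "k = Suc i mod ?n"
      have j: "j < ?n" "Suc j mod ?n = i" using i n by (auto simp: j_def)
      have k: "k < ?n" "k \<noteq> j" "k \<noteq> i" "j \<noteq> i"
        using i n by (auto simp: j_def k_def mod_Suc split: if_splits)
      have "{w, vs ! k} = {w, y}" using ed[OF i(1)] wT i(2) by (auto simp: k_def)
      moreover have "{vs ! j, w} = {w, y}" using ed[OF j(1)] wT i(2) j(2) by auto
      moreover have "vs ! k \<noteq> w" "vs ! j \<noteq> w"
        using k i dist j nth_eq_iff_index_eq[OF dist] by metis+
      ultimately have "vs ! k = vs ! j" by (auto simp: doubleton_eq_iff)
      thus False using k j nth_eq_iff_index_eq[OF dist] by simp
    next
      case False
      have "{vs ! i, vs ! (Suc i mod ?n)} \<in> T" if "i < ?n" for i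
      proof -
        have "Suc i mod ?n < ?n" using n by (intro mod_less_divisor) linarith
        hence "vs ! i \<in> set vs" "vs ! (Suc i mod ?n) \<in> set vs" using that by simp_all
        hence "{vs ! i, vs ! (Suc i mod ?n)} \<noteq> {w, y}" using False by (auto simp: doubleton_eq_iff)
        thus ?thesis using ed[OF that] by simp
      qed
      hence "is_cycle (V, T) vs" using n dist by (simp add: is_cycle_def)
      thus False using leaf.IH by simp
    qed
  qed
qed

lemma rtrancl_leaves_set:
  assumes "(a, b) \<in> R\<^sup>*" "a \<in> S" "b \<notin> S"
  shows "\<exists>x y. (x, y) \<in> R \<and> x \<in> S \<and> y \<notin> S"
  using assms by (induction rule: rtrancl_induct) auto

text \<open>Greedy growth: a path from \<open>r\<close> to a missing vertex leaves the current
  vertex set along an edge, which attaches the next leaf.\<close>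

lemma connected_has_grown_tree:
  assumes "finite V" "r \<in> V" "\<And>e. e \<in> T \<Longrightarrow> e \<subseteq> V" "connected_graph (V, T)"
  shows "\<exists>T' \<subseteq> T. grown_tree r (V - {r}) T'"
proof -
  have "\<exists>W T'. card W = n \<and> W \<subseteq> V - {r} \<and> T' \<subseteq> T \<and> grown_tree r W T'" if "n \<le> card (V - {r})" for n
    using that
  proof (induction n)
    case 0
    show ?case using grown_tree.root by (intro exI[of _ "{}"]) auto
  next
    case (Suc n)
    then obtain W T' where W: "card W = n" "W \<subseteq> V - {r}" "T' \<subseteq> T" "grown_tree r W T'" by auto
    have "W \<noteq> V - {r}" using W(1) Suc.prems by auto
    then obtain w0 where w0: "w0 \<in> V" "w0 \<notin> insert r W" using W(2) by auto
    have "(r, w0) \<in> (adj (V, T))\<^sup>*" using assms w0 by (auto simp: connected_graph_def)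
    then obtain y w where yw: "(y, w) \<in> adj (V, T)" "y \<in> insert r W" "w \<notin> insert r W"
      using rtrancl_leaves_set[of r w0 _ "insert r W"] w0 by blast
    hence e: "{w, y} \<in> T" by (simp add: adj_def insert_commute)
    hence "w \<in> V" using assms(3) by blast
    moreover have "card (insert w W) = Suc n"
      using W yw grown_tree_finite[OF W(4)] by simp
    ultimately show ?case
      using grown_tree.leaf[OF W(4) yw(3,2)] W e yw
      by (intro exI[of _ "insert w W"] exI[of _ "insert {w, y} T'"]) auto
  qed
  from this[of "card (V - {r})"] obtain W T'
    where W: "card W = card (V - {r})" "W \<subseteq> V - {r}" "T' \<subseteq> T" "grown_tree r W T'" by auto
  have "W = V - {r}" using W(1,2) assms(1) by (simp add: card_subset_eq)
  thus ?thesis using W by blast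
qed

lemma rtrancl_distinct_path:
  assumes "(a, b) \<in> R\<^sup>*"
  shows "\<exists>ps. ps \<noteq> [] \<and> hd ps = a \<and> last ps = b \<and> distinct ps \<and> successively (\<lambda>x y. (x, y) \<in> R) ps"
  using assms
proof (induction rule: converse_rtrancl_induct)
  case base
  show ?case by (intro exI[of _ "[b]"]) auto
next
  case (step a c)
  then obtain ps where ps: "ps \<noteq> []" "hd ps = c" "last ps = b" "distinct ps"
    "successively (\<lambda>x y. (x, y) \<in> R) ps" by blast
  show ?case
  proof (cases "a \<in> set ps")
    case True
    then obtain xs ys where "ps = xs @ a # ys" by (meson split_list)
    thus ?thesis using ps by (intro exI[of _ "a # ys"]) (auto simp: successively_append_iff)
  next
    case False
    thus ?thesis using ps step.hyps(1)
      by (intro exI[of _ "a # ps"]) (auto simp: successively_Cons)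
  qed
qed

text \<open>An edge of \<open>T\<close> outside the grown tree \<open>T'\<close> would close a cycle
  with the path in \<open>T'\<close> between its ends. This path has at least three vertices, since
  one with two would be the edge itself.\<close>

lemma tree_is_grown_tree:
  assumes "is_tree (V, T)" "r \<in> V"
  shows "grown_tree r (V - {r}) T"
proof -
  have sg: "finite V" "\<And>e. e \<in> T \<Longrightarrow> e \<subseteq> V \<and> card e = 2"
    and con: "connected_graph (V, T)" and acyc: "\<And>vs. \<not> is_cycle (V, T) vs"
    using assms(1) by (auto simp: is_tree_def simple_graph_def)
  obtain T' where T': "T' \<subseteq> T" "grown_tree r (V - {r}) T'"
    using connected_has_grown_tree[OF sg(1) assms(2) _ con] sg(2) by blast
  have "e \<in> T'" if e: "e \<in> T" for e
  proof (rule ccontr)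
    assume ne: "e \<notin> T'"
    obtain a b where ab: "e = {a, b}" "a \<noteq> b" using sg(2)[OF e] by (auto simp: card_2_iff)
    have "(a, b) \<in> (adj (V, T'))\<^sup>*"
      using grown_tree_connected[OF T'(2) assms(2)] sg(2)[OF e] ab by (auto simp: connected_graph_def)
    then obtain ps where ps: "ps \<noteq> []" "hd ps = a" "last ps = b" "distinct ps"
      "successively (\<lambda>x y. (x, y) \<in> adj (V, T')) ps"
      using rtrancl_distinct_path by metis
    let ?n = "length ps"
    have nth: "{ps ! i, ps ! Suc i} \<in> T'" if "Suc i < ?n" for i
      using ps(5) that by (auto simp: successively_conv_nth adj_def)
    have a0: "ps ! 0 = a" and bn: "ps ! (?n - 1) = b"
      using ps by (auto simp: hd_conv_nth last_conv_nth)
    have "?n \<noteq> 1" using a0 bn ab by auto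
    moreover have "?n \<noteq> 2" using a0 bn nth[of 0] ne ab by (auto simp: numeral_2_eq_2)
    moreover have "?n \<noteq> 0" using ps(1) by simp
    ultimately have n3: "?n \<ge> 3" by linarith
    have "is_cycle (V, T) ps"
      unfolding is_cycle_def
    proof (intro conjI allI impI)
      fix i assume i: "i < ?n"
      show "{ps ! i, ps ! (Suc i mod ?n)} \<in> edges (V, T)"
      proof (cases "Suc i < ?n")
        case True
        thus ?thesis using nth T'(1) by auto
      next
        case False
        hence n: "Suc i = ?n" using i by simp
        have "i = ?n - 1" using n by simp
        moreover have "Suc i mod ?n = 0" unfolding n by simp
        ultimately show ?thesis using a0 bn e ab by (simp add: insert_commute)
      qed
    qed (use n3 ps in auto)
    thus False using acyc by blast
  qed
  hence "T = T'" using T'(1) by blast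
  thus ?thesis using T'(2) by simp
qed

lemma spanning_trees_grown:
  assumes "simple_graph (V, E)" "r \<in> V"
  shows "spanning_trees (V, E) = {T. T \<subseteq> E \<and> grown_tree r (V - {r}) T}"
proof -
  have "is_tree (V, T) \<longleftrightarrow> grown_tree r (V - {r}) T" if "T \<subseteq> E" for T
  proof
    assume "grown_tree r (V - {r}) T"
    moreover have "simple_graph (V, T)" using assms(1) that by (auto simp: simple_graph_def)
    ultimately show "is_tree (V, T)"
      unfolding is_tree_def using grown_tree_connected[of r V T] grown_tree_no_cycle[of r _ T V] assms(2) by blast
  qed (rule tree_is_grown_tree[OF _ assms(2)])
  thus ?thesis by (auto simp: spanning_trees_def)
qed

section \<open>Incidence determinants as sums over spanning trees\<close>

definition incidence :: "'v set set \<Rightarrow> ('v set \<Rightarrow> 'v \<Rightarrow> int) \<Rightarrow> bool" where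
  "incidence E b \<longleftrightarrow> (\<forall>e\<in>E. \<exists>a c. e = {a, c} \<and> a \<noteq> c \<and> b e a = 1 \<and> b e c = -1
     \<and> (\<forall>w. w \<notin> e \<longrightarrow> b e w = 0))"

text \<open>The last leaf is incident with the last edge only; removing both contributes minus the
  square of an entry 1 or -1. Hence the sign depends on the number of vertices, not on the
  tree.\<close>

lemma inc_det_grown_tree:
  fixes x :: "'v set \<Rightarrow> 'r::comm_ring_1"
  assumes "grown_tree r W T" "T \<subseteq> E" "incidence E b"
  shows "inc_det b W T {} x = (-1) ^ card W"
  using assms
proof (induction rule: grown_tree.induct)
  case root
  show ?case by (simp add: inc_det_def)
next
  case (leaf W T w y)
  let ?e = "{w, y}" and ?A = "Inl ` T \<union> Inr ` W" and ?M = "inc_mat b {} x"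
  have fin: "finite W" "finite T" using grown_tree_finite[OF leaf.hyps(1)] by auto
  have wT: "w \<notin> e" if "e \<in> T" for e
    using grown_tree_edge_subset[OF leaf.hyps(1) that] leaf.hyps(2) by auto
  have b0: "b e w = 0" if "e \<in> T" for e
    using leaf.prems wT[OF that] that by (fastforce simp: incidence_def)
  have "b ?e w * b ?e w = 1"
  proof -
    have "?e \<in> E" using leaf.prems(1) by simp
    then obtain a c where ac: "?e = {a, c}" "b ?e a = 1" "b ?e c = -1"
      using leaf.prems(2) unfolding incidence_def by meson
    have "w = a \<or> w = c" using ac(1) by blast
    hence "b ?e w = 1 \<or> b ?e w = -1" using ac(2,3) by (elim disjE) simp_all
    thus ?thesis by (elim disjE) simp_all
  qed
  hence bb: "(of_int (b ?e w) :: 'r) * of_int (b ?e w) = 1"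
    unfolding of_int_mult[symmetric] by simp
  have sets: "Inl ` insert ?e T \<union> Inr ` insert w W = insert (Inr w) (insert (Inl ?e) ?A)" by auto
  have "inc_det b (insert w W) (insert ?e T) {} x
      = - (?M (Inr w) (Inl ?e) * ?M (Inl ?e) (Inr w)) * det_on ?A ?M"
    unfolding inc_det_def sets using fin leaf.hyps(2) wT b0 by (intro det_on_pendant) auto
  also have "\<dots> = - inc_det b W T {} x" by (simp add: bb inc_det_def)
  also have "\<dots> = (-1) ^ card (insert w W)" using leaf fin by simp
  finally show ?case .
qed

text \<open>The cut vector of an edge is the difference of \<open>y\<close> at its ends, where the
  root, having no column, counts as 0.\<close>

lemma cut_vec_edge:
  assumes "finite W" "incidence E b" "e \<in> E"
  obtains a c where "e = {a, c}" "a \<noteq> c" "b e a = 1" "b e c = -1"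
    "\<forall>y. cut_vec b W y e = (if a \<in> W then y a else 0) - (if c \<in> W then y c else 0)"
proof -
  obtain a c where ac: "e = {a, c}" "a \<noteq> c" "b e a = 1" "b e c = -1" "\<forall>w. w \<notin> e \<longrightarrow> b e w = 0"
    using bspec[OF assms(2)[unfolded incidence_def] assms(3)] by (elim exE conjE) (rule that)
  have "cut_vec b W y e = (if a \<in> W then y a else 0) - (if c \<in> W then y c else 0)" for y
  proof -
    have "cut_vec b W y e = (\<Sum>w\<in>W. (if w = a then y a else 0) - (if w = c then y c else 0))"
      unfolding cut_vec_def using ac by (intro sum.cong) auto
    thus ?thesis using assms(1) by (simp add: sum_subtractf)
  qed
  thus thesis using ac that by blast
qed

text \<open>With fewer or more edges than non-root vertices, a zero block is too large. With equally
  many, \<open>T\<close> cannot be connected, since otherwise it would be a grown tree by counting,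
  and a null vector exists.\<close>

lemma inc_det_not_grown_tree:
  fixes x :: "'v set \<Rightarrow> 'r::idom"
  assumes "simple_graph (V, E)" "r \<in> V" "T \<subseteq> E" "incidence E b" "\<not> grown_tree r (V - {r}) T"
  shows "inc_det b (V - {r}) T {} x = 0"
proof -
  let ?W = "V - {r}"
  have fin: "finite V" "finite ?W" and sub: "\<And>e. e \<in> T \<Longrightarrow> e \<subseteq> V"
    using assms by (auto simp: simple_graph_def)
  have finT: "finite T" using sub fin(1) by (meson PowI finite_Pow_iff finite_subset subsetI)
  have cards: "card (Inl ` T :: ('v set + 'v) set) = card T" "card (Inr ` ?W :: ('v set + 'v) set) = card ?W"
    by (auto simp: card_image)
  consider "card T < card ?W" | "card ?W < card T" | "card T = card ?W" by linarith
  thus ?thesis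
  proof cases
    case 1
    thus ?thesis unfolding inc_det_def
      using finT fin cards by (intro det_on_zero_block) auto
  next
    case 2
    \<comment> \<open>Here the large zero block is that of the edges, as no edge carries a
      variable.\<close>
    thus ?thesis unfolding inc_det_def Un_commute[of "Inl ` T"]
      using finT fin cards by (intro det_on_zero_block) auto
  next
    case 3
    have "\<not> connected_graph (V, T)"
    proof
      assume "connected_graph (V, T)"
      then obtain T' where "T' \<subseteq> T" "grown_tree r ?W T'"
        using connected_has_grown_tree[OF fin(1) assms(2) sub] by blast
      moreover have "T' = T" using calculation grown_tree_card 3 finT by (metis card_subset_eq)
      ultimately show False using assms(5) by simp
    qed
    hence "\<exists>u\<in>V. (r, u) \<notin> (adj (V, T))\<^sup>*"
      using assms(2) adj_sym rtrancl_trans unfolding connected_graph_def fst_conv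
      by (metis empty_iff)
    then obtain u where u: "u \<in> V" "(r, u) \<notin> (adj (V, T))\<^sup>*" by blast
    \<comment> \<open>The indicator of the vertices outside the component of the root: it is
      constant along every edge of \<open>T\<close>.\<close>
    define y where "y = (\<lambda>w. if (r, w) \<in> (adj (V, T))\<^sup>* then 0 else 1 :: int)"
    have yr: "y r = 0" by (simp add: y_def)
    show ?thesis
    proof (rule inc_det_null[where y = y and w = u])
      fix e assume e: "e \<in> T"
      obtain a c where ac: "e = {a, c}"
        and cut: "cut_vec b ?W y e = (if a \<in> ?W then y a else 0) - (if c \<in> ?W then y c else 0)"
        using cut_vec_edge[OF fin(2) assms(4)] e assms(3) by blast
      have "(a, c) \<in> adj (V, T)" "(c, a) \<in> adj (V, T)" using e ac by (auto simp: adj_def insert_commute)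
      hence "(r, a) \<in> (adj (V, T))\<^sup>* \<longleftrightarrow> (r, c) \<in> (adj (V, T))\<^sup>*"
        by (meson rtrancl.rtrancl_into_rtrancl)
      hence "y a = y c" by (simp add: y_def)
      moreover have "a \<in> V" "c \<in> V" using sub[OF e] ac by auto
      ultimately have "cut_vec b ?W y e = 0" using cut yr by auto
      thus "(of_int (cut_vec b ?W y e) :: 'r) = 0" by simp
    qed (use finT fin u in \<open>auto simp: y_def\<close>)
  qed
qed

lemma inc_det_expand:
  fixes x :: "'e \<Rightarrow> 'r::comm_ring_1"
  assumes "finite I" "finite T" "finite W" "T \<inter> I = {}"
  shows "inc_det b W (T \<union> I) I x = (\<Sum>S\<in>Pow I. (\<Prod>e\<in>I - S. x e) * inc_det b W (T \<union> S) {} x)"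
  using assms
proof (induction I arbitrary: T rule: finite_induct)
  case (insert e I)
  have e: "e \<notin> T \<union> I" using insert by auto
  let ?g = "\<lambda>S. (\<Prod>e\<in>insert e I - S. x e) * inc_det b W (T \<union> S) {} x"
  have "inc_det b W (T \<union> insert e I) (insert e I) x
      = x e * inc_det b W (T \<union> I) I x + inc_det b W (insert e T \<union> I) I x"
    using inc_det_insert[of "T \<union> I" W e I b x] insert e by simp
  also have "inc_det b W (T \<union> I) I x = (\<Sum>S\<in>Pow I. (\<Prod>e\<in>I - S. x e) * inc_det b W (T \<union> S) {} x)"
    using insert by (intro insert.IH) auto
  also have "x e * \<dots> = (\<Sum>S\<in>Pow I. ?g S)"
    unfolding sum_distrib_left
  proof (intro sum.cong refl)
    fix S assume "S \<in> Pow I"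
    hence "insert e I - S = insert e (I - S)" using insert by auto
    thus "x e * ((\<Prod>e\<in>I - S. x e) * inc_det b W (T \<union> S) {} x) = ?g S"
      using insert by (simp add: mult.assoc)
  qed
  also have "inc_det b W (insert e T \<union> I) I x
      = (\<Sum>S\<in>Pow I. (\<Prod>e\<in>I - S. x e) * inc_det b W (insert e T \<union> S) {} x)"
    using insert by (intro insert.IH) auto
  also have "\<dots> = (\<Sum>S\<in>Pow I. ?g (insert e S))"
  proof (intro sum.cong refl)
    fix S assume "S \<in> Pow I"
    hence "insert e I - insert e S = I - S" using insert by auto
    thus "(\<Prod>e\<in>I - S. x e) * inc_det b W (insert e T \<union> S) {} x = ?g (insert e S)" by simp
  qed
  also have "\<dots> = (\<Sum>S\<in>insert e ` Pow I. ?g S)"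
  proof -
    have "inj_on (insert e) (Pow I)"
    proof (rule inj_onI)
      fix S S' assume "S \<in> Pow I" "S' \<in> Pow I" "insert e S = insert e S'"
      thus "S = S'" using insert_ident[of e S S'] insert.hyps by blast
    qed
    thus ?thesis by (simp add: sum.reindex)
  qed
  also have "(\<Sum>S\<in>Pow I. ?g S) + (\<Sum>S\<in>insert e ` Pow I. ?g S) = (\<Sum>S\<in>Pow (insert e I). ?g S)"
    unfolding Pow_insert using insert by (intro sum.union_disjoint[symmetric]) auto
  finally show ?case .
qed simp

lemma eval_kirchhoff:
  fixes x :: "'v set \<Rightarrow> 'r::idom"
  assumes "simple_graph (V, E)" "r \<in> V" "incidence E b"
  shows "inc_det b (V - {r}) E E x = (-1) ^ card (V - {r}) * eval_mpoly x (kirchhoff (V, E))"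
proof -
  let ?W = "V - {r}"
  have fin: "finite V" "finite ?W" and sub: "\<And>e. e \<in> E \<Longrightarrow> e \<subseteq> V"
    using assms by (auto simp: simple_graph_def)
  have finE: "finite E" using sub fin(1) by (meson PowI finite_Pow_iff finite_subset subsetI)
  have "inc_det b ?W E E x = (\<Sum>S\<in>Pow E. (\<Prod>e\<in>E - S. x e) * inc_det b ?W S {} x)"
    using inc_det_expand[of E "{}" ?W b x] finE fin by simp
  also have "\<dots> = (\<Sum>S\<in>spanning_trees (V, E). (\<Prod>e\<in>E - S. x e) * inc_det b ?W S {} x)"
    unfolding spanning_trees_grown[OF assms(1,2)] using finE
    by (intro sum.mono_neutral_right) (auto intro!: inc_det_not_grown_tree[OF assms(1,2) _ assms(3)])
  also have "\<dots> = (\<Sum>S\<in>spanning_trees (V, E). (\<Prod>e\<in>E - S. x e) * (-1) ^ card ?W)"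
    unfolding spanning_trees_grown[OF assms(1,2)]
    by (intro sum.cong) (auto simp: inc_det_grown_tree[OF _ _ assms(3)])
  also have "\<dots> = (-1) ^ card ?W * eval_mpoly x (kirchhoff (V, E))"
    by (simp add: kirchhoff_def eval_mpoly_sum eval_mpoly_prod sum_distrib_left mult.commute)
  finally show ?thesis .
qed

section \<open>Decompletions\<close>

lemma handshake:
  assumes "simple_graph (V, E)"
  shows "(\<Sum>w\<in>V. card {e \<in> E. w \<in> e}) = 2 * card E"
proof -
  have fin: "finite V" and E: "\<And>e. e \<in> E \<Longrightarrow> e \<subseteq> V \<and> card e = 2"
    using assms by (auto simp: simple_graph_def)
  have "E \<subseteq> Pow V" using E by blast
  hence finE: "finite E" using fin finite_subset by blast
  have "(\<Sum>w\<in>V. card {e \<in> E. w \<in> e}) = (\<Sum>w\<in>V. \<Sum>e\<in>E. of_bool (w \<in> e))"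
    using finE by (simp add: card_eq_sum_of_bool)
  also have "\<dots> = (\<Sum>e\<in>E. \<Sum>w\<in>V. of_bool (w \<in> e))" by (rule sum.swap)
  also have "\<dots> = (\<Sum>e\<in>E. 2)"
  proof (rule sum.cong)
    fix e assume e: "e \<in> E"
    have "(\<Sum>w\<in>V. of_bool (w \<in> e)) = card {w \<in> V. w \<in> e}" using fin by (simp add: card_eq_sum_of_bool)
    also have "{w \<in> V. w \<in> e} = e" using E[OF e] by blast
    finally show "(\<Sum>w\<in>V. of_bool (w \<in> e)) = (2::nat)" using E[OF e] by simp
  qed simp
  finally show ?thesis by simp
qed

text \<open>The orientation makes every edge at \<open>r\<close> point away from \<open>r\<close> and every other edge at \<open>u\<close>
  point into \<open>u\<close>, so that no signs occur in the rows of the edges at these two vertices.\<close>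

lemma incidence_exists:
  assumes "\<And>e. e \<in> E \<Longrightarrow> card e = 2" "r \<noteq> u"
  obtains b where "incidence E b" "\<And>e w. e \<in> E \<Longrightarrow> b e w \<noteq> 0 \<longleftrightarrow> w \<in> e"
    "\<And>e. e \<in> E \<Longrightarrow> u \<in> e \<Longrightarrow> b e u = 1"
    "\<And>e w. e \<in> E \<Longrightarrow> e = {r, w} \<Longrightarrow> b e w = 1"
proof -
  \<comment> \<open>The head of an edge. Both demands can be met at once since \<open>r\<close> and
    \<open>u\<close> differ; an edge between them has head \<open>u\<close>.\<close>
  define pos where "pos = (\<lambda>e. SOME w. w \<in> e \<and> w \<noteq> r \<and> (u \<in> e \<longrightarrow> w = u))"
  define b where "b = (\<lambda>e w. if w \<in> e then if w = pos e then 1 else -1 else 0 :: int)"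
  have pos: "pos e \<in> e \<and> pos e \<noteq> r \<and> (u \<in> e \<longrightarrow> pos e = u)" if e: "e \<in> E" for e
    unfolding pos_def
  proof (rule someI_ex)
    obtain a c where "e = {a, c}" "a \<noteq> c" using assms(1)[OF e] by (auto simp: card_2_iff)
    thus "\<exists>w. w \<in> e \<and> w \<noteq> r \<and> (u \<in> e \<longrightarrow> w = u)" using assms(2) by auto
  qed
  have inc: "incidence E b" unfolding incidence_def
  proof
    fix e assume e: "e \<in> E"
    obtain a c where ac: "e = {a, c}" "a \<noteq> c" using assms(1)[OF e] by (auto simp: card_2_iff)
    have "pos e = a \<or> pos e = c" using pos[OF e] ac by auto
    thus "\<exists>a c. e = {a, c} \<and> a \<noteq> c \<and> b e a = 1 \<and> b e c = - 1 \<and> (\<forall>w. w \<notin> e \<longrightarrow> b e w = 0)"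
    proof
      assume p: "pos e = a"
      have "a \<in> e" "c \<in> e" using ac(1) by auto
      hence "b e a = 1" "b e c = -1" using ac(2) by (simp_all add: b_def p)
      thus ?thesis using ac by (intro exI[of _ a] exI[of _ c]) (simp add: b_def)
    next
      assume p: "pos e = c"
      have "a \<in> e" "c \<in> e" using ac(1) by auto
      hence "b e c = 1" "b e a = -1" using ac(2) by (simp_all add: b_def p)
      moreover have "e = {c, a}" using ac(1) by auto
      ultimately show ?thesis using ac(2) by (intro exI[of _ c] exI[of _ a]) (simp add: b_def)
    qed
  qed
  have nz: "b e w \<noteq> 0 \<longleftrightarrow> w \<in> e" for e w by (simp add: b_def)
  have u1: "b e u = 1" if "e \<in> E" "u \<in> e" for e using pos that by (simp add: b_def)
  have r1: "b e w = 1" if "e \<in> E" "e = {r, w}" for e w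
  proof -
    have "w \<in> e" "e \<subseteq> {r, w}" using that(2) by auto
    moreover have "w = pos e" using pos[OF that(1)] calculation(2) by blast
    ultimately show ?thesis by (simp add: b_def)
  qed
  show thesis by (rule that[OF inc nz u1 r1])
qed

text \<open>\<open>r\<close> and \<open>u\<close> are two neighbours of the removed vertex, so they
  keep degree 3. The edge count comes from the handshake identity of the completion, minus four
  edges and one vertex; four distinct neighbours of the removed vertex give the bound 4.\<close>

lemma primitive_divergent_decomposition:
  assumes "primitive_divergent G"
  obtains r u e1 e2 e3 where "simple_graph G" "r \<in> verts G" "u \<in> verts G" "r \<noteq> u"
    "card (verts G) \<ge> 4" "card (edges G) + 2 = 2 * card (verts G)"
    "{e \<in> edges G. r \<in> e} = {e1, e2, e3}" "e1 \<noteq> e2" "e1 \<noteq> e3" "e2 \<noteq> e3"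
    "u \<notin> e2" "u \<notin> e3" "card {e \<in> edges G. u \<in> e} = 3"
proof -
  obtain K v where K: "simple_graph K" "regular 4 K" "v \<in> verts K" "G = delete_vertex K v"
    using assms unfolding primitive_divergent_def is_decompletion_def by blast
  obtain V E where VE: "K = (V, E)" by fastforce
  have fin: "finite V" and E: "\<And>e. e \<in> E \<Longrightarrow> e \<subseteq> V \<and> card e = 2" and v: "v \<in> V"
    using K by (auto simp: simple_graph_def VE)
  have "E \<subseteq> Pow V" using E by blast
  hence finE: "finite E" using fin finite_subset by blast
  have deg: "card {e \<in> E. w \<in> e} = 4" if "w \<in> V" for w using K(2) that by (simp add: regular_def VE)
  let ?S = "{e \<in> E. v \<in> e}"
  have vG: "verts G = V - {v}" and eG: "edges G = E - ?S" using K(4) by (auto simp: delete_vertex_def VE)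
  have finS: "finite ?S" using finE by simp
  have other: "\<exists>w\<in>V - {v}. e = {v, w}" if "e \<in> ?S" for e
  proof -
    have e: "e \<in> E" "v \<in> e" using that by auto
    obtain a c where ac: "e = {a, c}" "a \<noteq> c" using E[OF e(1)] by (auto simp: card_2_iff)
    show ?thesis
    proof (cases "a = v")
      case True
      thus ?thesis using ac E[OF e(1)] by (intro bexI[of _ c]) auto
    next
      case False
      hence "c = v" using e(2) ac by auto
      thus ?thesis using ac E[OF e(1)] False by (intro bexI[of _ a]) auto
    qed
  qed
  have "4 \<le> card (V - {v})"
  proof -
    have "?S \<subseteq> (\<lambda>w. {v, w}) ` (V - {v})" using other by blast
    hence "card ?S \<le> card (V - {v})" using fin by (meson surj_card_le finite_Diff)
    thus ?thesis using deg[OF v] by simp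
  qed
  hence cV: "card (verts G) \<ge> 4" by (simp add: vG)
  have "4 * card V = 2 * card E"
    using handshake[of V E] K(1) deg by (simp add: VE)
  moreover have "card (edges G) + 4 = card E"
    unfolding eG using finE deg[OF v] card_mono[of E ?S] by (subst card_Diff_subset) auto
  moreover have "card V = Suc (card (verts G))"
    unfolding vG using v fin by (metis card_Suc_Diff1)
  ultimately have cE: "card (edges G) + 2 = 2 * card (verts G)" by simp
  have sg: "simple_graph G" unfolding simple_graph_def vG eG using E fin by auto
  obtain f1 f2 where f: "f1 \<in> ?S" "f2 \<in> ?S" "f1 \<noteq> f2"
  proof -
    have "\<not> card ?S \<le> Suc 0" using deg[OF v] by simp
    thus ?thesis using that card_le_Suc0_iff_eq[OF finS] by blast
  qed
  obtain r where r: "r \<in> V - {v}" "f1 = {v, r}" using other[OF f(1)] by blast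
  obtain u where u: "u \<in> V - {v}" "f2 = {v, u}" using other[OF f(2)] by blast
  have ru: "r \<noteq> u" using r u f(3) by auto
  have deg3: "card {e \<in> edges G. w \<in> e} = 3" if w: "w \<in> V - {v}" "{v, w} \<in> E" for w
  proof -
    have "{e \<in> edges G. w \<in> e} = {e \<in> E. w \<in> e} - {{v, w}}"
    proof -
      have "e = {v, w}" if "e \<in> ?S" "w \<in> e" for e using other[OF that(1)] that(2) w(1) by auto
      thus ?thesis unfolding eG by auto
    qed
    thus ?thesis using deg[of w] w finE by simp
  qed
  have r3: "card {e \<in> edges G. r \<in> e} = 3" using deg3[OF r(1)] r(2) f(1) by simp
  have u3: "card {e \<in> edges G. u \<in> e} = 3" using deg3[OF u(1)] u(2) f(2) by simp
  obtain g1 g2 g3 where g: "{e \<in> edges G. r \<in> e} = {g1, g2, g3}" "g1 \<noteq> g2" "g1 \<noteq> g3" "g2 \<noteq> g3"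
    using r3 by (auto simp: card_3_iff)
  have only: "e = {r, u}" if "e \<in> {g1, g2, g3}" "u \<in> e" for e
  proof -
    have "e \<in> edges G" "r \<in> e" using that(1) g(1) by auto
    moreover have "card e = 2" using calculation(1) E by (auto simp: eG)
    ultimately show ?thesis using ru that(2) by (auto simp: card_2_iff)
  qed
  have uniq: "x = y" if "x \<in> {g1, g2, g3}" "y \<in> {g1, g2, g3}" "u \<in> x" "u \<in> y" for x y
    using only[OF that(1,3)] only[OF that(2,4)] by simp
  \<comment> \<open>At most one edge at \<open>r\<close> leads to \<open>u\<close>; if there is one,
    it is named \<open>e1\<close>.\<close>
  have "\<exists>e1 e2 e3. {e \<in> edges G. r \<in> e} = {e1, e2, e3} \<and> e1 \<noteq> e2 \<and> e1 \<noteq> e3 \<and> e2 \<noteq> e3 \<and> u \<notin> e2 \<and> u \<notin> e3"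
  proof -
    consider "u \<in> g2" | "u \<in> g3" | "u \<notin> g2" "u \<notin> g3" by blast
    thus ?thesis
    proof cases
      case 1
      hence "u \<notin> g1" "u \<notin> g3" using uniq[of g1 g2] uniq[of g2 g3] g(2-4) by blast+
      thus ?thesis using g by (intro exI[of _ g2] exI[of _ g1] exI[of _ g3]) (simp add: insert_commute)
    next
      case 2
      hence "u \<notin> g1" "u \<notin> g2" using uniq[of g1 g3] uniq[of g2 g3] g(2-4) by blast+
      thus ?thesis using g by (intro exI[of _ g3] exI[of _ g1] exI[of _ g2]) (simp add: insert_commute)
    next
      case 3
      thus ?thesis using g by blast
    qed
  qed
  then obtain e1 e2 e3 where e: "{e \<in> edges G. r \<in> e} = {e1, e2, e3}" "e1 \<noteq> e2" "e1 \<noteq> e3" "e2 \<noteq> e3"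
    "u \<notin> e2" "u \<notin> e3" by blast
  show thesis
    by (rule that[OF sg _ _ ru cV cE e u3]) (use r u in \<open>auto simp: vG\<close>)
qed

text \<open>\<open>T\<close> and \<open>F\<close> are built from the graph and its orientation
  alone, so the same integer \<open>top_coeff T p F\<close> serves every field of characteristic
  \<open>p\<close>.\<close>

lemma c2_cong_top_coeff:
  fixes V :: "'v set"
  assumes G: "simple_graph (V, E)" "r \<in> V" "u \<in> V" "r \<noteq> u"
    and cV: "card V \<ge> 4" and cE: "card E + 2 = 2 * card V"
    and re: "{e \<in> E. r \<in> e} = {e1, e2, e3}" and e: "e1 \<noteq> e2" "e1 \<noteq> e3" "e2 \<noteq> e3"
    and ue: "u \<notin> e2" "u \<notin> e3" and u3: "card {e \<in> E. u \<in> e} = 3"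
    and b: "incidence E b" "\<And>e w. e \<in> E \<Longrightarrow> b e w \<noteq> 0 \<longleftrightarrow> w \<in> e"
      "\<And>e. e \<in> E \<Longrightarrow> u \<in> e \<Longrightarrow> b e u = 1" "\<And>e w. e \<in> E \<Longrightarrow> e = {r, w} \<Longrightarrow> b e w = 1"
    and m: "prime p" "s \<ge> 1" "CARD('m::{field,finite}) = p ^ s"
  defines "W \<equiv> V - {r}" and "T \<equiv> E - {e1, e2, e3}"
  defines "F \<equiv> inc_det b W (insert e1 T) T var * inc_minor b W (insert e1 (insert e2 T)) T e2 e3 var"
  shows "[c2 TYPE('m) (V, E) = - (top_coeff T p F ^ s)] (mod int p)"
proof -
  have fin: "finite V" and E: "\<And>e. e \<in> E \<Longrightarrow> e \<subseteq> V \<and> card e = 2"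
    using G(1) by (auto simp: simple_graph_def)
  have "E \<subseteq> Pow V" using E by blast
  hence finE: "finite E" using fin finite_subset by blast
  have finW: "finite W" and finT: "finite T" using fin finE by (auto simp: W_def T_def)
  have eE: "e1 \<in> E" "e2 \<in> E" "e3 \<in> E" "r \<in> e1" "r \<in> e2" "r \<in> e3" using re by blast+
  have ET: "E = insert e1 (insert e2 (insert e3 T))" unfolding T_def using eE(1-3) by blast
  have eT: "e1 \<notin> T" "e2 \<notin> T" "e3 \<notin> T" by (auto simp: T_def)
  have cW: "card V = Suc (card W)" unfolding W_def using card_Suc_Diff1[OF fin G(2)] by simp
  have cardE: "card E = card T + 3" unfolding ET using eT e finT by simp
  have cutT: "cut_vec b W (\<lambda>_. 1) e = 0" if "e \<in> T" for e
  proof -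
    have eE': "e \<in> E" using that by (simp add: T_def)
    obtain a c where ac: "e = {a, c}" "a \<noteq> c" "b e a = 1" "b e c = -1"
      and cut: "\<forall>y. cut_vec b W y e = (if a \<in> W then y a else 0) - (if c \<in> W then y c else 0)"
      by (rule cut_vec_edge[OF finW b(1) eE'])
    have "r \<notin> e" using that re unfolding T_def by blast
    moreover have "a \<in> e" "c \<in> e" using ac(1) by auto
    ultimately have "a \<in> W" "c \<in> W" using E[OF eE'] unfolding W_def by blast+
    thus ?thesis using cut by simp
  qed
  have cute: "cut_vec b W (\<lambda>_. 1) e = 1" if e': "e \<in> E" "r \<in> e" for e
  proof -
    obtain a c where ac: "e = {a, c}" "a \<noteq> c" "b e a = 1" "b e c = -1"
      and cut: "\<forall>y. cut_vec b W y e = (if a \<in> W then y a else 0) - (if c \<in> W then y c else 0)"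
      by (rule cut_vec_edge[OF finW b(1) e'(1)])
    have "c = r"
    proof (rule ccontr)
      assume "c \<noteq> r"
      hence "e = {r, c}" using ac(1) e'(2) by blast
      thus False using b(4)[OF e'(1)] ac(4) by simp
    qed
    moreover have "a \<in> e" using ac(1) by simp
    hence "a \<in> W" using ac(2) calculation E[OF e'(1)] unfolding W_def by blast
    ultimately show ?thesis using cut by (simp add: W_def)
  qed
  have ustar: "{e \<in> insert e1 T. b e u \<noteq> 0} = {e \<in> E. u \<in> e}"
  proof -
    have "e \<in> insert e1 T \<and> b e u \<noteq> 0 \<longleftrightarrow> e \<in> E \<and> u \<in> e" for e
      using b(2)[of e u] ue unfolding ET by blast
    thus ?thesis by blast
  qed
  have cT: "card T + 3 = 2 * card W" using cE cW cardE by simp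
  have W3: "card W \<ge> 3" using cV cW by simp
  \<comment> \<open>The two factors have degree at most \<open>card T + 1 - card W\<close> and
    \<open>card T + 2 - card W\<close>; \<open>card T + 3 = 2 * card W\<close> makes the sum exactly
    \<open>card T\<close>.\<close>
  have degF: "deg_le T (card T) F"
  proof -
    have "deg_le T ((card (insert e1 T) - card W) + (card (insert e1 (insert e2 T)) - card W)) F"
      unfolding F_def using finT finW eT e
      by (intro deg_le_mult deg_le_inc_det deg_le_inc_minor) auto
    moreover have "(card (insert e1 T) - card W) + (card (insert e1 (insert e2 T)) - card W) = card T"
      using finT eT e cT W3 by simp
    ultimately show ?thesis by simp
  qed
  have T0: "T \<noteq> {}" using cT W3 by auto
  \<comment> \<open>Oddness makes the sign \<open>(-1) ^ card T\<close> cancel the minus sign in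
    \<open>card_zeros_top_coeff\<close>.\<close>
  have odd: "odd (card T)" using cT by presburger
  let ?q = "CARD('m)"
  have pq: "int p dvd int ?q" using m by (simp add: dvd_power)
  let ?N = "zeros E (inc_det b W E E :: ('v set \<Rightarrow> 'm) \<Rightarrow> 'm)"
  have "point_count TYPE('m) E (kirchhoff (V, E)) = ?N"
  proof -
    have "inc_det b W E E x = (-1) ^ card W * eval_mpoly x (kirchhoff (V, E))" for x :: "'v set \<Rightarrow> 'm"
      unfolding W_def by (rule eval_kirchhoff[OF G(1,2) b(1)])
    thus ?thesis by (simp add: point_count_def)
  qed
  hence "c2 TYPE('m) (V, E) = int ?N div int (?q ^ 2) mod int ?q"
    by (simp only: c2_def snd_conv)
  hence "[c2 TYPE('m) (V, E) = int ?N div int (?q ^ 2)] (mod int p)"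
    by (simp only: cong_def mod_mod_cancel[OF pq])
  also have "[int ?N div int (?q ^ 2) = - int (zeros T (\<lambda>x :: 'v set \<Rightarrow> 'm. eval_mpoly x F))] (mod int p)"
    unfolding ET F_def
  proof (rule zeros_div_square_cong[where u = u and s = s])
    show "card {e \<in> insert e1 T. b e u \<noteq> 0} = 3" unfolding ustar using u3 by simp
    show "u \<in> W" using G(3,4) by (simp add: W_def)
    show "b e u = 1" if "e \<in> insert e1 T" "b e u \<noteq> 0" for e
      using that b(2)[of e u] b(3)[of e] unfolding ET by blast
    show "b e2 u = 0" "b e3 u = 0" using b(2)[OF eE(2)] b(2)[OF eE(3)] ue by blast+
  qed (fact finT finW cutT cute[OF eE(1,4)] cute[OF eE(2,5)] cute[OF eE(3,6)] eT e cT W3 m)+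
  also have "[- int (zeros T (\<lambda>x :: 'v set \<Rightarrow> 'm. eval_mpoly x F)) = - (top_coeff T p F ^ s)] (mod int p)"
  proof -
    have "(of_nat (zeros T (\<lambda>x :: 'v set \<Rightarrow> 'm. eval_mpoly x F)) :: 'm) = of_int (top_coeff T p F ^ s)"
      using card_zeros_top_coeff[OF finT T0 degF m(1,3)] odd by simp
    hence "(of_int (int (zeros T (\<lambda>x :: 'v set \<Rightarrow> 'm. eval_mpoly x F))) :: 'm) = of_int (top_coeff T p F ^ s)"
      by simp
    hence "[int (zeros T (\<lambda>x :: 'v set \<Rightarrow> 'm. eval_mpoly x F)) = top_coeff T p F ^ s] (mod int p)"
      unfolding of_int_eq_iff_cong_CHAR CHAR_eq_of_CARD[OF m(3,1)] .
    thus ?thesis by (simp add: cong_minus_minus_iff)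
  qed
  finally show ?thesis .
qed

theorem theorem1:
  fixes G :: "'v ugraph" and p s q :: nat
  assumes "prime p"
    and "s \<ge> 1"
    and "q = p ^ s"
    and "CARD('Fq::{field,finite}) = q"
    and "CARD('Fp::{field,finite}) = p"
    and "primitive_divergent G"
  shows "[c2 TYPE('Fq) G = (-1) ^ (s + 1) * c2 TYPE('Fp) G ^ s] (mod int p)"
proof -
  obtain r u e1 e2 e3 where G: "simple_graph G" "r \<in> verts G" "u \<in> verts G" "r \<noteq> u"
    "card (verts G) \<ge> 4" "card (edges G) + 2 = 2 * card (verts G)"
    "{e \<in> edges G. r \<in> e} = {e1, e2, e3}" "e1 \<noteq> e2" "e1 \<noteq> e3" "e2 \<noteq> e3"
    "u \<notin> e2" "u \<notin> e3" "card {e \<in> edges G. u \<in> e} = 3"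
    by (rule primitive_divergent_decomposition[OF assms(6)])
  obtain V E where VE: "G = (V, E)" by fastforce
  note G' = G[unfolded VE fst_conv snd_conv]
  have "\<And>e. e \<in> E \<Longrightarrow> card e = 2" using G'(1) by (auto simp: simple_graph_def)
  then obtain b where b: "incidence E b" "\<And>e w. e \<in> E \<Longrightarrow> b e w \<noteq> 0 \<longleftrightarrow> w \<in> e"
    "\<And>e. e \<in> E \<Longrightarrow> u \<in> e \<Longrightarrow> b e u = 1" "\<And>e w. e \<in> E \<Longrightarrow> e = {r, w} \<Longrightarrow> b e w = 1"
    using incidence_exists[of E r u] G'(4) by blast
  \<comment> \<open>One integer for both fields; the prime field is the case of exponent 1.\<close>
  obtain a where q: "[c2 TYPE('Fq) G = - (a ^ s)] (mod int p)"
    and p: "[c2 TYPE('Fp) G = - (a ^ 1)] (mod int p)"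
    using c2_cong_top_coeff[OF G' b assms(1,2), where ?'m = 'Fq]
      c2_cong_top_coeff[OF G' b assms(1) order_refl, where ?'m = 'Fp] assms(3-5)
    by (auto simp: VE)
  have "[(-1) ^ (s + 1) * c2 TYPE('Fp) G ^ s = (-1) ^ (s + 1) * (- (a ^ 1)) ^ s] (mod int p)"
    using p by (intro cong_mult cong_pow cong_refl)
  also have "(-1) ^ (s + 1) * (- (a ^ 1)) ^ s = - (a ^ s)"
    by (cases "even s") simp_all
  finally show ?thesis using q by (meson cong_sym cong_trans)
qed

end
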